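(* Let $\alpha\in(0,2)$, $\sigma>0$, $\Delta>0$, and let $L^{(\alpha)}=(L^{(\alpha)}_t)_{t\in\mathbb R}$ be a two-sided symmetric $\alpha$-stable Lévy process with $L^{(\alpha)}_1\sim S_\alpha(\sigma,0,0)$. Let $\Theta\subseteq(-\infty,0)$ be compact, let $\vartheta_0$ be an interior point of $\Theta$, and let $Y_t(\vartheta)=\int_{-\infty}^te^{\vartheta(t-s)}dL_s^{(\alpha)}$, $t\ge0$, $\vartheta\in\Theta$, be the corresponding family of symmetric $\alpha$-stable Ornstein-Uhlenbeck processes. Then the Whittle estimator $\widehat\vartheta_n^{(\Delta,\alpha)}$ based on the observations $Y_\Delta(\vartheta_0),\dots,Y_{n\Delta}(\vartheta_0)$ satisfies, as $n\to\infty$, $$\widehat\vartheta_n^{(\Delta,\alpha)}\overset{\mathbb P}{\longrightarrow}\vartheta_0 .$$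
   Context: $Z\sim S_\alpha(\sigma,0,0)$ means $\mathbb E e^{izZ}=\exp(-\sigma^\alpha|z|^\alpha)$; a symmetric $\alpha$-stable Lévy process is a Lévy process with increments $L_t-L_s\sim S_\alpha(\sigma(t-s)^{1/\alpha},0,0)$, $s<t$. Let $Y^{(\Delta)}_k:=Y_{k\Delta}(\vartheta_0)$, let $I_n(\omega)=\frac{1}{2\pi n}\big|\sum_{k=1}^nY_k^{(\Delta)}e^{ik\omega}\big|^2$ be the periodogram, and $\omega_j=\pi j/n$ for $j=-n+1,\dots,n$. For the Ornstein-Uhlenbeck family, $\Pi^{(\Delta)}(z,\vartheta)=1-e^{\vartheta\Delta}z$. The (adjusted) Whittle function is $$W_n^{(\alpha)}(\vartheta)=\frac{\pi}{n^{2/\alpha}}\sum_{j=-n+1}^n|\Pi^{(\Delta)}(e^{i\omega_j},\vartheta)|^2I_n(\omega_j),\quad\vartheta\in\Theta,$$ and the Whittle estimator is $\widehat\vartheta_n^{(\Delta,\alpha)}:=\arg\min_{\vartheta\in\Theta}W_n^{(\alpha)}(\vartheta)$. $\overset{\mathbb P}{\longrightarrow}$ denotes convergence in probability. *)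

theory Defs
  imports "HOL-Probability.Probability"
begin

definition tendsto_in_prob ::
  "'a measure \<Rightarrow> (nat \<Rightarrow> 'a \<Rightarrow> real) \<Rightarrow> ('a \<Rightarrow> real) \<Rightarrow> bool" where
  "tendsto_in_prob M X Z \<longleftrightarrow>
     (\<forall>\<epsilon>>0. (\<lambda>n. measure M {\<omega> \<in> space M. \<bar>X n \<omega> - Z \<omega>\<bar> > \<epsilon>}) \<longlonglongrightarrow> 0)"

text \<open>\<open>Z\<close> has the symmetric stable law \<open>S\<^sub>\<alpha>(\<sigma>, 0, 0)\<close>, given by its characteristic function.\<close>

definition sas_distributed :: "'a measure \<Rightarrow> real \<Rightarrow> real \<Rightarrow> ('a \<Rightarrow> real) \<Rightarrow> bool" where
  "sas_distributed M \<alpha> \<sigma> Z \<longleftrightarrow>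
     Z \<in> borel_measurable M \<and>
     (\<forall>z::real. char (distr M borel Z) z = complex_of_real (exp (- (\<sigma> powr \<alpha>) * \<bar>z\<bar> powr \<alpha>)))"

definition cadlag :: "(real \<Rightarrow> real) \<Rightarrow> bool" where
  "cadlag x \<longleftrightarrow> (\<forall>t. (x \<longlongrightarrow> x t) (at_right t) \<and> (\<exists>l. (x \<longlongrightarrow> l) (at_left t)))"

text \<open>A two-sided process is indexed by all real times, and its increments are independent and
  stationary over the whole line. Stochastic continuity follows from these conditions.\<close>

definition two_sided_levy_process :: "'a measure \<Rightarrow> (real \<Rightarrow> 'a \<Rightarrow> real) \<Rightarrow> bool" where
  "two_sided_levy_process M L \<longleftrightarrow>
     (\<forall>t. L t \<in> borel_measurable M) \<and>
     (AE \<omega> in M. L 0 \<omega> = 0) \<and>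
     (\<forall>(m::nat) (t::nat \<Rightarrow> real). strict_mono_on {..m} t \<longrightarrow>
        prob_space.indep_vars M (\<lambda>_. borel) (\<lambda>i \<omega>. L (t (Suc i)) \<omega> - L (t i) \<omega>) {..<m}) \<and>
     (\<forall>s t h. s < t \<longrightarrow>
        distr M borel (\<lambda>\<omega>. L (t + h) \<omega> - L (s + h) \<omega>) = distr M borel (\<lambda>\<omega>. L t \<omega> - L s \<omega>)) \<and>
     (AE \<omega> in M. cadlag (\<lambda>t. L t \<omega>))"

definition two_sided_sas_levy_process ::
  "'a measure \<Rightarrow> real \<Rightarrow> real \<Rightarrow> (real \<Rightarrow> 'a \<Rightarrow> real) \<Rightarrow> bool" where
  "two_sided_sas_levy_process M \<alpha> \<sigma> L \<longleftrightarrow>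
     two_sided_levy_process M L \<and>
     (\<forall>s t. s < t \<longrightarrow> sas_distributed M \<alpha> (\<sigma> * (t - s) powr (1 / \<alpha>)) (\<lambda>\<omega>. L t \<omega> - L s \<omega>))"

text \<open>A deterministic step function \<open>\<Sum> c \<cdot> 1\<^bsub>(a, b]\<^esub>\<close> is represented by a list of triples
  \<open>(c, a, b)\<close>. The intervals may overlap. The condition \<open>a \<le> b\<close> matters: for \<open>b < a\<close> the
  indicator would vanish while the increment \<open>L b - L a\<close> would not.\<close>

definition step_rep :: "(real \<times> real \<times> real) list \<Rightarrow> bool" where
  "step_rep \<phi> \<longleftrightarrow> (\<forall>(c, a, b) \<in> set \<phi>. a \<le> b)"

definition step_fun :: "(real \<times> real \<times> real) list \<Rightarrow> real \<Rightarrow> real" where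
  "step_fun \<phi> s = (\<Sum>(c, a, b) \<leftarrow> \<phi>. c * indicator {a<..b} s)"

definition step_integral ::
  "(real \<Rightarrow> 'a \<Rightarrow> real) \<Rightarrow> (real \<times> real \<times> real) list \<Rightarrow> 'a \<Rightarrow> real" where
  "step_integral L \<phi> \<omega> = (\<Sum>(c, a, b) \<leftarrow> \<phi>. c * (L b \<omega> - L a \<omega>))"

text \<open>\<open>X\<close> is a version of \<open>\<integral> f dL\<close> over the real line: the usual extension of the integral of step
  functions, as a limit in probability along step functions converging to \<open>f\<close> in \<open>L\<^sup>\<alpha>(\<real>)\<close>. For
  a symmetric \<open>\<alpha>\<close>-stable \<open>L\<close> the integral exists for each \<open>f \<in> L\<^sup>\<alpha>(\<real>)\<close> and, up to
  null sets, does not depend on the approximating sequence.\<close>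

definition is_stable_integral ::
  "'a measure \<Rightarrow> (real \<Rightarrow> 'a \<Rightarrow> real) \<Rightarrow> real \<Rightarrow> (real \<Rightarrow> real) \<Rightarrow> ('a \<Rightarrow> real) \<Rightarrow> bool" where
  "is_stable_integral M L \<alpha> f X \<longleftrightarrow>
     f \<in> borel_measurable borel \<and> X \<in> borel_measurable M \<and>
     (\<exists>\<phi>. (\<forall>n. step_rep (\<phi> n)) \<and>
          (\<lambda>n. \<integral>\<^sup>+ s. ennreal (\<bar>step_fun (\<phi> n) s - f s\<bar> powr \<alpha>) \<partial>lborel) \<longlonglongrightarrow> 0 \<and>
          tendsto_in_prob M (\<lambda>n. step_integral L (\<phi> n)) X)"

text \<open>The family \<open>Y\<^sub>t(\<theta>) = \<integral> e\<^bsup>\<theta>(t - s)\<^esup> dL\<^sub>s\<close> over \<open>s \<in> (-\<infinity>, t]\<close>, for \<open>t \<ge> 0\<close> and \<open>\<theta> \<in> \<Theta>\<close>.\<close>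

definition sas_ou_family ::
  "'a measure \<Rightarrow> (real \<Rightarrow> 'a \<Rightarrow> real) \<Rightarrow> real \<Rightarrow> real set \<Rightarrow> (real \<Rightarrow> real \<Rightarrow> 'a \<Rightarrow> real) \<Rightarrow> bool" where
  "sas_ou_family M L \<alpha> \<Theta> Y \<longleftrightarrow>
     (\<forall>\<theta>\<in>\<Theta>. \<forall>t\<ge>0.
        is_stable_integral M L \<alpha> (\<lambda>s. indicator {..t} s * exp (\<theta> * (t - s))) (Y \<theta> t))"

text \<open>Observations are functions \<open>y\<close> on the naturals; only \<open>y 1, \<dots>, y n\<close> are used.\<close>

definition periodogram :: "(nat \<Rightarrow> real) \<Rightarrow> nat \<Rightarrow> real \<Rightarrow> real" where
  "periodogram y n w =
     1 / (2 * pi * real n) *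
     (cmod (\<Sum>k = 1..n. complex_of_real (y k) * exp (\<i> * of_nat k * complex_of_real w)))\<^sup>2"

definition ou_Pi :: "real \<Rightarrow> complex \<Rightarrow> real \<Rightarrow> complex" where
  "ou_Pi \<Delta> z \<theta> = 1 - complex_of_real (exp (\<theta> * \<Delta>)) * z"

definition fourier_freq :: "nat \<Rightarrow> int \<Rightarrow> real" where
  "fourier_freq n j = pi * real_of_int j / real n"

definition whittle_fun :: "real \<Rightarrow> real \<Rightarrow> (nat \<Rightarrow> real) \<Rightarrow> nat \<Rightarrow> real \<Rightarrow> real" where
  "whittle_fun \<alpha> \<Delta> y n \<theta> =
     pi / real n powr (2 / \<alpha>) *
     (\<Sum>j = - int n + 1..int n.
        (cmod (ou_Pi \<Delta> (exp (\<i> * complex_of_real (fourier_freq n j))) \<theta>))\<^sup>2 *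
        periodogram y n (fourier_freq n j))"

text \<open>Minimizers of the Whittle function over \<open>\<Theta>\<close> need not be unique, so an estimator is any
  sequence of random variables that selects a minimizer for each sample size \<open>n \<ge> 1\<close>.\<close>

definition whittle_estimator ::
  "'a measure \<Rightarrow> real \<Rightarrow> real \<Rightarrow> real set \<Rightarrow> (nat \<Rightarrow> 'a \<Rightarrow> real) \<Rightarrow> (nat \<Rightarrow> 'a \<Rightarrow> real) \<Rightarrow> bool" where
  "whittle_estimator M \<alpha> \<Delta> \<Theta> obs \<theta>\<^sub>h \<longleftrightarrow>
     (\<forall>n\<ge>1. \<theta>\<^sub>h n \<in> borel_measurable M \<and>
        (\<forall>\<omega>\<in>space M.
           is_arg_min (whittle_fun \<alpha> \<Delta> (\<lambda>k. obs k \<omega>) n) (\<lambda>\<theta>. \<theta> \<in> \<Theta>) (\<theta>\<^sub>h n \<omega>)))"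

end

theory Submission
  imports Defs "HOL-Real_Asymp.Real_Asymp"
begin

text \<open>Write \<open>y\<^sub>k = Y\<^sub>k\<^sub>\<Delta>(\<theta>\<^sub>0)\<close>, \<open>c = e\<^bsup>\<theta>\<^sub>0\<Delta>\<^esup>\<close> and \<open>Z\<^sub>k = y\<^sub>k\<^sub>+\<^sub>1 - c y\<^sub>k\<close>. Orthogonality of the
  characters over the \<open>2n\<close> frequencies turns the Whittle function into a quadratic in \<open>e\<^bsup>\<theta>\<Delta>\<^esup>\<close>, and
  minimality gives \<open>S \<bar>e\<^bsup>\<theta>\<^sub>h\<Delta>\<^esup> - c\<bar> \<le> 2 \<bar>N\<bar>\<close> with \<open>S = \<Sum> y\<^sub>k\<^sup>2\<close> and
  \<open>N = \<Sum> y\<^sub>k Z\<^sub>k - c y\<^sub>n\<^sup>2\<close>. Choose \<open>\<alpha>/2 < p < min \<alpha> 1\<close> and \<open>1/p < q < 2/\<alpha>\<close>. Subadditivity of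
  \<open>x\<^sup>p\<close> gives \<open>E \<bar>\<Sum> y\<^sub>k Z\<^sub>k\<bar>\<^sup>p = O(n)\<close>, so \<open>N\<close> is of smaller order than \<open>n\<^sup>q\<close>, while
  \<open>4 S \<ge> \<Sum> Z\<^sub>k\<^sup>2\<close> exceeds \<open>n\<^sup>q\<close> with probability tending to one. Independence of the
  innovations enters only through cosine transforms: moments are controlled by
  \<open>\<bar>z\<bar>\<^sup>p \<le> K \<integral> (1 - cos (tz)) t\<^bsup>-1-p\<^esup> dt\<close> and the sum of squares by the trigonometric polynomial
  \<open>\<Prod> (1 + cos (t Z\<^sub>k)) / 2\<close>.\<close>

section \<open>Integrals of step functions\<close>

text \<open>An increment of \<open>l\<close> over an interval telescopes over the grid cells inside
  it, and a cell lies in \<open>{a<..b}\<close> exactly when its right endpoint does. The function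
  \<open>l\<close> is arbitrary because two choices are used: a path of the process, which gives
  disjoint increments, and an indicator, which gives the step function itself.\<close>

lemma step_sum_refine:
  fixes l :: "real \<Rightarrow> real"
  assumes t: "strict_mono_on {..m} t"
    and P: "\<forall>(c, a, b) \<in> set \<phi>. a \<in> t ` {..m} \<and> b \<in> t ` {..m} \<and> a \<le> b"
  shows "(\<Sum>(c, a, b) \<leftarrow> \<phi>. c * (l b - l a))
     = (\<Sum>i<m. step_fun \<phi> (t (Suc i)) * (l (t (Suc i)) - l (t i)))"
  using P
proof (induction \<phi>)
  case Nil
  then show ?case by (simp add: step_fun_def)
next
  case (Cons x \<phi>)
  obtain c a b where x: "x = (c, a, b)" by (cases x)
  from Cons.prems x obtain p q where pq: "p \<le> m" "q \<le> m" "a = t p" "b = t q" "a \<le> b"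
    by auto
  have lt: "t i < t j \<longleftrightarrow> i < j" if "i \<le> m" "j \<le> m" for i j
    using strict_mono_on_less[OF t, of i j] that by auto
  have "p \<le> q" using lt[of q p] pq by force
  have ind: "indicator {a<..b} (t (Suc i)) = (if i \<in> {p..<q} then 1 else (0::real))"
    if "i < m" for i
    using lt[of p "Suc i"] lt[of q "Suc i"] that pq by (auto simp: indicator_def not_less)
  have "(\<Sum>i<m. indicator {a<..b} (t (Suc i)) * (l (t (Suc i)) - l (t i)))
      = (\<Sum>i<m. if i \<in> {p..<q} then l (t (Suc i)) - l (t i) else 0)"
    by (intro sum.cong refl) (simp add: ind)
  also have "\<dots> = (\<Sum>i\<in>{p..<q}. l (t (Suc i)) - l (t i))"
    using pq by (intro sum.mono_neutral_cong_right) auto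
  also have "\<dots> = l b - l a"
    using sum_Suc_diff'[OF \<open>p \<le> q\<close>, of "\<lambda>i. l (t i)"] pq by simp
  finally have e: "(\<Sum>i<m. indicator {a<..b} (t (Suc i)) * (l (t (Suc i)) - l (t i))) = l b - l a" .
  have "(\<Sum>i<m. step_fun (x # \<phi>) (t (Suc i)) * (l (t (Suc i)) - l (t i)))
     = c * (\<Sum>i<m. indicator {a<..b} (t (Suc i)) * (l (t (Suc i)) - l (t i)))
       + (\<Sum>i<m. step_fun \<phi> (t (Suc i)) * (l (t (Suc i)) - l (t i)))"
    by (simp add: step_fun_def x sum_distrib_left sum.distrib[symmetric] algebra_simps)
  also have "\<dots> = (\<Sum>(c, a, b) \<leftarrow> x # \<phi>. c * (l b - l a))"
    using Cons e x by simp
  finally show ?case by simp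
qed

lemma strict_mono_enumeration:
  assumes "finite (P :: real set)" "P \<noteq> {}"
  obtains m t where "strict_mono_on {..m} t" "t ` {..m::nat} = P"
proof -
  define xs where "xs = sorted_list_of_set P"
  have xs: "set xs = P" "sorted_wrt (<) xs" "length xs = card P"
    using assms by (auto simp: xs_def)
  \<comment> \<open>The index set \<open>{..m}\<close> has \<open>m + 1\<close> elements, so the
    last index is \<open>card P - 1\<close>; since \<open>P\<close> is nonempty, the natural
    subtraction does not truncate.\<close>
  have "card P > 0" using assms by (simp add: card_gt_0_iff)
  then have le: "i \<le> card P - 1 \<longleftrightarrow> i < length xs" for i using xs(3) by linarith
  show thesis
  proof
    show "strict_mono_on {..card P - 1} (\<lambda>i. xs ! i)"
      using sorted_wrt_nth_less[OF xs(2)] by (intro strict_mono_onI) (simp only: atMost_iff le)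
    show "(\<lambda>i. xs ! i) ` {..card P - 1} = P"
    proof -
      have "{..card P - 1} = {..<length xs}"
        by (auto simp only: atMost_iff lessThan_iff le)
      then show ?thesis using xs(1) nth_image[of "length xs" xs] by (simp add: atLeast0LessThan del: atMost_iff)
    qed
  qed
qed

lemma step_rep_refinement:
  assumes "step_rep \<phi>"
  obtains m t where "strict_mono_on {..m::nat} t"
    "\<forall>(c, a, b) \<in> set \<phi>. a \<in> t ` {..m} \<and> b \<in> t ` {..m} \<and> a \<le> b"
proof -
  \<comment> \<open>The point 0 keeps the grid nonempty when the list is empty.\<close>
  define P where "P = insert 0 ((\<lambda>(c, a, b). a) ` set \<phi> \<union> (\<lambda>(c, a, b). b) ` set \<phi>)"
  have "finite P" "P \<noteq> {}" by (auto simp: P_def)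
  then obtain m t where mt: "strict_mono_on {..m} t" "t ` {..m::nat} = P"
    by (rule strict_mono_enumeration)
  show thesis
  proof (rule that[OF mt(1)], unfold mt(2))
    show "\<forall>(c, a, b) \<in> set \<phi>. a \<in> P \<and> b \<in> P \<and> a \<le> b"
      using assms unfolding P_def step_rep_def by (auto simp: image_iff) (metis prod.case)+
  qed
qed

lemma step_fun_refine:
  assumes t: "strict_mono_on {..m} t"
    and P: "\<forall>(c, a, b) \<in> set \<phi>. a \<in> t ` {..m} \<and> b \<in> t ` {..m} \<and> a \<le> b"
  shows "step_fun \<phi> s = (\<Sum>i<m. step_fun \<phi> (t (Suc i)) * indicator {t i<..t (Suc i)} s)"
proof -
  \<comment> \<open>The function \<open>indicator {s..}\<close> increases by 1 from \<open>a\<close>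
    to \<open>b\<close> exactly when \<open>s\<close> lies in the interval, so it can replace the
    path in the refinement formula.\<close>
  have ind: "indicator {a<..b} s = indicator {s..} b - (indicator {s..} a :: real)" if "a \<le> b" for a b
    using that by (auto simp: indicator_def)
  have "step_fun \<phi> s = (\<Sum>(c, a, b) \<leftarrow> \<phi>. c * (indicator {s..} b - indicator {s..} a))"
    unfolding step_fun_def using P by (intro arg_cong[where f=sum_list] map_cong refl) (auto simp: ind)
  also have "\<dots> = (\<Sum>i<m. step_fun \<phi> (t (Suc i)) * (indicator {s..} (t (Suc i)) - indicator {s..} (t i)))"
    by (rule step_sum_refine[OF t P])
  also have "\<dots> = (\<Sum>i<m. step_fun \<phi> (t (Suc i)) * indicator {t i<..t (Suc i)} s)"
  proof (intro sum.cong refl)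
    fix i assume "i \<in> {..<m}"
    then have "t i \<le> t (Suc i)" using strict_mono_onD[OF t, of i "Suc i"] by force
    then show "step_fun \<phi> (t (Suc i)) * (indicator {s..} (t (Suc i)) - indicator {s..} (t i))
      = step_fun \<phi> (t (Suc i)) * indicator {t i<..t (Suc i)} s" by (simp add: ind)
  qed
  finally show ?thesis .
qed

lemma step_fun_measurable [measurable]: "step_fun \<phi> \<in> borel_measurable borel"
  unfolding step_fun_def by (induction \<phi>) (auto simp: case_prod_beta)

text \<open>After refinement the cells are disjoint, so at most one summand is nonzero at each point
  and the power passes through the sum.\<close>

lemma nn_integral_step_fun_powr:
  assumes t: "strict_mono_on {..m} t" and "0 < \<alpha>"
    and P: "\<forall>(c, a, b) \<in> set \<phi>. a \<in> t ` {..m} \<and> b \<in> t ` {..m} \<and> a \<le> b"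
  shows "(\<integral>\<^sup>+ s. ennreal (\<bar>step_fun \<phi> s\<bar> powr \<alpha>) \<partial>lborel)
     = ennreal (\<Sum>i<m. \<bar>step_fun \<phi> (t (Suc i))\<bar> powr \<alpha> * (t (Suc i) - t i))"
proof -
  let ?d = "\<lambda>i. step_fun \<phi> (t (Suc i))"
  have inc: "t i \<le> t j" if "i \<le> j" "j \<le> m" for i j
    using strict_mono_on_leD[OF t, of i j] that by auto
  have pt: "\<bar>step_fun \<phi> s\<bar> powr \<alpha> = (\<Sum>i<m. \<bar>?d i\<bar> powr \<alpha> * indicator {t i<..t (Suc i)} s)" for s
  proof (cases "\<exists>j<m. s \<in> {t j<..t (Suc j)}")
    case True
    then obtain j where j: "j < m" "s \<in> {t j<..t (Suc j)}" by blast
    have ind: "indicator {t i<..t (Suc i)} s = (if i = j then 1 else (0::real))" if "i < m" for i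
    proof (cases i j rule: linorder_cases)
      case less
      then show ?thesis using inc[of "Suc i" j] j by (auto simp: indicator_def)
    next
      case greater
      then show ?thesis using inc[of "Suc j" i] j that by (auto simp: indicator_def)
    qed (use j in auto)
    have *: "(\<Sum>i<m. g i * indicator {t i<..t (Suc i)} s) = g j" for g :: "nat \<Rightarrow> real"
      using j by (simp add: ind sum.delta if_distrib[of "\<lambda>x. _ * x"] cong: if_cong)
    show ?thesis unfolding step_fun_refine[OF t P, of s] * by simp
  next
    case False
    then have ind: "indicator {t i<..t (Suc i)} s = (0::real)" if "i < m" for i
      using that by (auto simp: indicator_def)
    show ?thesis unfolding step_fun_refine[OF t P, of s] using \<open>0 < \<alpha>\<close> by (simp add: ind)
  qed
  have "(\<integral>\<^sup>+ s. ennreal (\<bar>step_fun \<phi> s\<bar> powr \<alpha>) \<partial>lborel)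
      = (\<Sum>i<m. \<integral>\<^sup>+ s. ennreal (\<bar>?d i\<bar> powr \<alpha>) * indicator {t i<..t (Suc i)} s \<partial>lborel)"
  proof (subst nn_integral_sum[symmetric])
    have "ennreal (\<bar>step_fun \<phi> s\<bar> powr \<alpha>)
        = (\<Sum>i<m. ennreal (\<bar>?d i\<bar> powr \<alpha>) * indicator {t i<..t (Suc i)} s)" for s
      by (subst pt, subst sum_ennreal[symmetric]) (auto simp: ennreal_mult' ennreal_indicator)
    then show "(\<integral>\<^sup>+ s. ennreal (\<bar>step_fun \<phi> s\<bar> powr \<alpha>) \<partial>lborel)
        = (\<integral>\<^sup>+ s. (\<Sum>i<m. ennreal (\<bar>?d i\<bar> powr \<alpha>) * indicator {t i<..t (Suc i)} s) \<partial>lborel)"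
      by (intro nn_integral_cong)
  qed auto
  also have "\<dots> = (\<Sum>i<m. ennreal (\<bar>?d i\<bar> powr \<alpha> * (t (Suc i) - t i)))"
    by (intro sum.cong refl) (simp add: nn_integral_cmult_indicator inc ennreal_mult)
  also have "\<dots> = ennreal (\<Sum>i<m. \<bar>?d i\<bar> powr \<alpha> * (t (Suc i) - t i))"
    by (intro sum_ennreal) (simp add: inc)
  finally show ?thesis .
qed

section \<open>Cosine transforms of stable integrals\<close>

text \<open>A substitute for the triangle inequality that also covers \<alpha> < 1, where the
  L^\<alpha> expression is not a norm. Either \<open>b\<close> is small relative to \<open>a\<close>
  or \<open>a\<close> is bounded by a multiple of \<open>b\<close>. The factor of the first term
  tends to 1 as \<eta> tends to 0, which is what continuity requires.\<close>

lemma abs_add_powr_le: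
  fixes a b \<alpha> \<eta> :: real
  assumes "0 < \<alpha>" "0 < \<eta>"
  shows "\<bar>a + b\<bar> powr \<alpha> \<le> (1 + \<eta>) powr \<alpha> * \<bar>a\<bar> powr \<alpha> + (1 + 1 / \<eta>) powr \<alpha> * \<bar>b\<bar> powr \<alpha>"
proof (cases "\<bar>b\<bar> \<le> \<eta> * \<bar>a\<bar>")
  case True
  then have "\<bar>a + b\<bar> \<le> (1 + \<eta>) * \<bar>a\<bar>" by (simp add: algebra_simps)
  then have "\<bar>a + b\<bar> powr \<alpha> \<le> ((1 + \<eta>) * \<bar>a\<bar>) powr \<alpha>"
    using assms by (intro powr_mono2) auto
  also have "\<dots> = (1 + \<eta>) powr \<alpha> * \<bar>a\<bar> powr \<alpha>" using assms by (intro powr_mult)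
  finally show ?thesis by (simp add: add_increasing2)
next
  case False
  then have "\<bar>a\<bar> \<le> 1 / \<eta> * \<bar>b\<bar>" using assms by (simp add: field_simps)
  then have "\<bar>a + b\<bar> \<le> (1 + 1 / \<eta>) * \<bar>b\<bar>" by (simp add: algebra_simps)
  then have "\<bar>a + b\<bar> powr \<alpha> \<le> ((1 + 1 / \<eta>) * \<bar>b\<bar>) powr \<alpha>"
    using assms by (intro powr_mono2) auto
  also have "\<dots> = (1 + 1 / \<eta>) powr \<alpha> * \<bar>b\<bar> powr \<alpha>" using assms by (intro powr_mult)
  finally show ?thesis by (simp add: add_increasing)
qed

lemma nn_integral_abs_add_powr_le:
  fixes f g :: "'a \<Rightarrow> real"
  assumes [measurable]: "f \<in> borel_measurable N" "g \<in> borel_measurable N" and "0 < \<alpha>" "0 < \<eta>"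
  shows "(\<integral>\<^sup>+s. ennreal (\<bar>f s + g s\<bar> powr \<alpha>) \<partial>N)
    \<le> ennreal ((1 + \<eta>) powr \<alpha>) * (\<integral>\<^sup>+s. ennreal (\<bar>f s\<bar> powr \<alpha>) \<partial>N)
      + ennreal ((1 + 1 / \<eta>) powr \<alpha>) * (\<integral>\<^sup>+s. ennreal (\<bar>g s\<bar> powr \<alpha>) \<partial>N)"
proof -
  have "(\<integral>\<^sup>+s. ennreal (\<bar>f s + g s\<bar> powr \<alpha>) \<partial>N)
    \<le> (\<integral>\<^sup>+s. ennreal ((1 + \<eta>) powr \<alpha>) * ennreal (\<bar>f s\<bar> powr \<alpha>)
        + ennreal ((1 + 1 / \<eta>) powr \<alpha>) * ennreal (\<bar>g s\<bar> powr \<alpha>) \<partial>N)"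
    using abs_add_powr_le[OF assms(3,4)]
    by (intro nn_integral_mono) (simp add: ennreal_mult[symmetric] ennreal_plus[symmetric] del: ennreal_plus)
  also have "\<dots> = ennreal ((1 + \<eta>) powr \<alpha>) * (\<integral>\<^sup>+s. ennreal (\<bar>f s\<bar> powr \<alpha>) \<partial>N)
      + ennreal ((1 + 1 / \<eta>) powr \<alpha>) * (\<integral>\<^sup>+s. ennreal (\<bar>g s\<bar> powr \<alpha>) \<partial>N)"
    by (simp add: nn_integral_add nn_integral_cmult)
  finally show ?thesis .
qed

text \<open>Continuity of the L^\<alpha> functional for every \<alpha> > 0. The two-sided comparison
  of \<open>g n\<close> and \<open>f\<close> has a factor that is made close to 1 by fixing \<eta>
  first; the remaining term is then a constant times an error tending to 0.\<close>

lemma tendsto_nn_integral_powr: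
  fixes f :: "'a \<Rightarrow> real" and g :: "nat \<Rightarrow> 'a \<Rightarrow> real"
  assumes [measurable]: "f \<in> borel_measurable N" "\<And>n. g n \<in> borel_measurable N"
    and \<alpha>: "0 < \<alpha>"
    and lim: "(\<lambda>n. \<integral>\<^sup>+s. ennreal (\<bar>g n s - f s\<bar> powr \<alpha>) \<partial>N) \<longlonglongrightarrow> 0"
    and fin: "\<And>n. (\<integral>\<^sup>+s. ennreal (\<bar>g n s\<bar> powr \<alpha>) \<partial>N) < \<infinity>"
  shows "(\<integral>\<^sup>+s. ennreal (\<bar>f s\<bar> powr \<alpha>) \<partial>N) < \<infinity>"
    and "(\<lambda>n. enn2real (\<integral>\<^sup>+s. ennreal (\<bar>g n s\<bar> powr \<alpha>) \<partial>N))
      \<longlonglongrightarrow> enn2real (\<integral>\<^sup>+s. ennreal (\<bar>f s\<bar> powr \<alpha>) \<partial>N)"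
proof -
  define X where "X n = (\<integral>\<^sup>+s. ennreal (\<bar>g n s\<bar> powr \<alpha>) \<partial>N)" for n
  define I where "I = (\<integral>\<^sup>+s. ennreal (\<bar>f s\<bar> powr \<alpha>) \<partial>N)"
  define E where "E n = (\<integral>\<^sup>+s. ennreal (\<bar>g n s - f s\<bar> powr \<alpha>) \<partial>N)" for n
  have up: "X n \<le> ennreal ((1 + \<eta>) powr \<alpha>) * I + ennreal ((1 + 1 / \<eta>) powr \<alpha>) * E n" if "0 < \<eta>" for \<eta> n
    using nn_integral_abs_add_powr_le[of f N "\<lambda>s. g n s - f s" \<alpha> \<eta>] \<alpha> that
    by (simp add: X_def I_def E_def)
  have lo: "I \<le> ennreal ((1 + \<eta>) powr \<alpha>) * X n + ennreal ((1 + 1 / \<eta>) powr \<alpha>) * E n" if "0 < \<eta>" for \<eta> n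
    using nn_integral_abs_add_powr_le[of "g n" N "\<lambda>s. f s - g n s" \<alpha> \<eta>] \<alpha> that
    by (simp add: X_def I_def E_def abs_minus_commute)
  have Efin: "\<forall>\<^sub>F n in sequentially. E n < \<top>"
    using order_tendstoD(2)[OF lim, of \<top>] by (simp add: E_def)
  \<comment> \<open>One index with finite error is enough to bound the functional of
    \<open>f\<close>.\<close>
  then obtain n0 where n0: "E n0 < \<top>" by (auto simp: eventually_sequentially)
  have I: "I < \<top>"
    using lo[of 1 n0] n0 fin[of n0] by (intro le_less_trans[OF lo[of 1 n0]]) (auto simp: X_def ennreal_mult_less_top)
  then show "(\<integral>\<^sup>+s. ennreal (\<bar>f s\<bar> powr \<alpha>) \<partial>N) < \<infinity>" by (simp add: I_def)
  define x where "x n = enn2real (X n)" for n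
  define i where "i = enn2real I"
  define e where "e n = enn2real (E n)" for n
  have i0: "0 \<le> i" "0 \<le> x n" "0 \<le> e n" for n by (auto simp: i_def x_def e_def)
  have XI: "I = ennreal i" "X n = ennreal (x n)" for n
    using I fin[of n] by (auto simp: i_def x_def X_def less_top)
  have e0: "e \<longlonglongrightarrow> 0"
    using tendsto_enn2real[of _ 0] lim by (simp add: e_def[abs_def] E_def)
  have "(\<lambda>n. x n) \<longlonglongrightarrow> i"
  proof (rule LIMSEQ_I)
    fix r :: real assume "0 < r"
    \<comment> \<open>This quantity is the part of the final error that does not shrink with
      \<open>n\<close>; it vanishes at \<eta> = 0, so a small positive \<eta> brings it below half
      of \<open>r\<close>.\<close>
    have "((\<lambda>\<eta>. ((1 + \<eta>) powr \<alpha> - 1) * (1 + \<eta>) powr \<alpha> * i) \<longlongrightarrow> ((1 + 0) powr \<alpha> - 1) * (1 + 0) powr \<alpha> * i) (at_right 0)"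
      by (intro tendsto_intros) auto
    then have "\<forall>\<^sub>F \<eta> in at_right 0. ((1 + \<eta>) powr \<alpha> - 1) * (1 + \<eta>) powr \<alpha> * i < r / 2"
      using \<open>0 < r\<close> by (intro order_tendstoD) auto
    then have "\<forall>\<^sub>F \<eta>::real in at_right 0. ((1 + \<eta>) powr \<alpha> - 1) * (1 + \<eta>) powr \<alpha> * i < r / 2 \<and> 0 < \<eta>"
      by (intro eventually_conj) (auto simp: eventually_at_right_less)
    then obtain \<eta> where eta: "((1 + \<eta>) powr \<alpha> - 1) * (1 + \<eta>) powr \<alpha> * i < r / 2" "0 < \<eta>"
      using eventually_happens'[of "at_right (0::real)"] by force
    define A where "A = (1 + \<eta>) powr \<alpha>"
    define B where "B = (1 + 1 / \<eta>) powr \<alpha>"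
    have A1: "1 \<le> A" using eta \<alpha> unfolding A_def by (intro ge_one_powr_ge_zero) auto
    have B0: "0 \<le> B" by (simp add: B_def)
    have "(\<lambda>n. A * B * e n) \<longlonglongrightarrow> A * B * 0" by (intro tendsto_intros e0)
    then have "\<forall>\<^sub>F n in sequentially. A * B * e n < r / 2"
      using \<open>0 < r\<close> by (intro order_tendstoD) auto
    then have "\<forall>\<^sub>F n in sequentially. norm (x n - i) < r"
      using Efin
    proof eventually_elim
      fix n assume n: "A * B * e n < r / 2" "E n < \<top>"
      then have E: "E n = ennreal (e n)" by (simp add: e_def less_top)
      have 1: "x n \<le> A * i + B * e n"
        using up[OF eta(2), of n] i0 A1 B0 unfolding E XI A_def[symmetric] B_def[symmetric]
        by (simp add: ennreal_mult[symmetric] ennreal_plus[symmetric] del: ennreal_plus)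
      have 2: "i \<le> A * x n + B * e n"
        using lo[OF eta(2), of n] i0 A1 B0 unfolding E XI A_def[symmetric] B_def[symmetric]
        by (simp add: ennreal_mult[symmetric] ennreal_plus[symmetric] del: ennreal_plus)
      \<comment> \<open>The upper bound for \<open>x n\<close> is inserted into
        \<open>i - x n \<le> (A - 1) * x n + B * e n\<close>, so that only the fixed number
        \<open>i\<close> and the error remain on the right.\<close>
      have "(A - 1) * x n \<le> (A - 1) * (A * i + B * e n)" using A1 1 by (intro mult_left_mono) auto
      then have "i - x n \<le> (A - 1) * A * i + A * B * e n" using 2 by (simp add: algebra_simps)
      moreover have "x n - i \<le> (A - 1) * A * i + A * B * e n"
      proof -
        have "1 * ((A - 1) * i) \<le> A * ((A - 1) * i)" using A1 i0 by (intro mult_right_mono) auto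
        moreover have "1 * (B * e n) \<le> A * (B * e n)" using A1 B0 i0 by (intro mult_right_mono) auto
        ultimately show ?thesis using 1 by (simp add: algebra_simps)
      qed
      ultimately show "norm (x n - i) < r"
        using n(1) eta(1) unfolding A_def[symmetric] by (simp add: abs_less_iff)
    qed
    then show "\<exists>no. \<forall>n\<ge>no. norm (x n - i) < r" by (simp add: eventually_sequentially)
  qed
  then show "(\<lambda>n. enn2real (\<integral>\<^sup>+s. ennreal (\<bar>g n s\<bar> powr \<alpha>) \<partial>N))
      \<longlonglongrightarrow> enn2real (\<integral>\<^sup>+s. ennreal (\<bar>f s\<bar> powr \<alpha>) \<partial>N)"
    by (simp add: x_def i_def X_def I_def)
qed

lemma (in prob_space) expectation_cos_eq_Re_char:
  assumes [measurable]: "X \<in> borel_measurable M"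
  shows "expectation (\<lambda>\<omega>. cos (t * X \<omega>)) = Re (char (distr M borel X) t)"
proof -
  have "integrable M (\<lambda>\<omega>. iexp (t * X \<omega>))"
    by (rule integrable_iexp) auto
  then have "expectation (\<lambda>\<omega>. Re (iexp (t * X \<omega>))) = Re (expectation (\<lambda>\<omega>. iexp (t * X \<omega>)))"
    by (rule integral_Re)
  then show ?thesis
    by (simp add: char_def integral_distr Re_exp)
qed

text \<open>The cosine is bounded and 1-Lipschitz: where the variables are close their cosines
  differ by at most \<open>r / 2\<close>, elsewhere by at most 2.\<close>

lemma (in prob_space) tendsto_expectation_cos:
  assumes [measurable]: "\<And>n. X n \<in> borel_measurable M" "Z \<in> borel_measurable M"
    and X: "tendsto_in_prob M X Z"
  shows "(\<lambda>n. expectation (\<lambda>\<omega>. cos (X n \<omega>))) \<longlonglongrightarrow> expectation (\<lambda>\<omega>. cos (Z \<omega>))"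
proof (rule LIMSEQ_I)
  fix r :: real assume r: "0 < r"
  have ic: "integrable M (\<lambda>\<omega>. cos (Y \<omega>))" if [measurable]: "Y \<in> borel_measurable M" for Y :: "'a \<Rightarrow> real"
    by (rule integrable_const_bound[where B=1]) auto
  define A where "A n = {\<omega> \<in> space M. \<bar>X n \<omega> - Z \<omega>\<bar> > r / 2}" for n
  have [measurable]: "A n \<in> sets M" for n by (simp add: A_def)
  have "(\<lambda>n. prob (A n)) \<longlonglongrightarrow> 0"
    using X half_gt_zero[OF r] unfolding tendsto_in_prob_def A_def by blast
  \<comment> \<open>The exceptional event is weighted by 2, so a probability below
    \<open>r / 4\<close> contributes less than \<open>r / 2\<close>.\<close>
  then have "\<forall>\<^sub>F n in sequentially. prob (A n) < r / 4"
    using r by (intro order_tendstoD) auto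
  then have "\<forall>\<^sub>F n in sequentially. norm (expectation (\<lambda>\<omega>. cos (X n \<omega>)) - expectation (\<lambda>\<omega>. cos (Z \<omega>))) < r"
  proof eventually_elim
    fix n assume n: "prob (A n) < r / 4"
    have pt: "\<bar>cos (X n \<omega>) - cos (Z \<omega>)\<bar> \<le> r / 2 + 2 * indicator (A n) \<omega>" if "\<omega> \<in> space M" for \<omega>
    proof (cases "\<omega> \<in> A n")
      case True
      have "\<bar>cos (X n \<omega>)\<bar> \<le> 1" "\<bar>cos (Z \<omega>)\<bar> \<le> 1" by auto
      then have "\<bar>cos (X n \<omega>) - cos (Z \<omega>)\<bar> \<le> 2" by linarith
      with True r show ?thesis by simp
    next
      case False
      have "\<bar>cos (X n \<omega>) - cos (Z \<omega>)\<bar> \<le> \<bar>X n \<omega> - Z \<omega>\<bar>"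
      proof -
        have "cos (X n \<omega>) - cos (Z \<omega>) = 2 * sin ((X n \<omega> + Z \<omega>) / 2) * sin ((Z \<omega> - X n \<omega>) / 2)"
          by (rule cos_diff_cos)
        also have "\<bar>\<dots>\<bar> \<le> 2 * 1 * \<bar>(Z \<omega> - X n \<omega>) / 2\<bar>"
          unfolding abs_mult by (intro mult_mono abs_sin_x_le_abs_x abs_sin_le_one) auto
        finally show ?thesis by simp
      qed
      with False that show ?thesis by (simp add: A_def)
    qed
    have "norm (expectation (\<lambda>\<omega>. cos (X n \<omega>)) - expectation (\<lambda>\<omega>. cos (Z \<omega>)))
       = norm (expectation (\<lambda>\<omega>. cos (X n \<omega>) - cos (Z \<omega>)))"
      by (simp add: ic)
    also have "\<dots> \<le> expectation (\<lambda>\<omega>. norm (cos (X n \<omega>) - cos (Z \<omega>)))"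
      by (rule integral_norm_bound)
    also have "\<dots> \<le> expectation (\<lambda>\<omega>. r / 2 + 2 * indicator (A n) \<omega>)"
    proof (intro integral_mono)
      show "integrable M (\<lambda>\<omega>. r / 2 + 2 * indicator (A n) \<omega>)"
        by (intro Bochner_Integration.integrable_add integrable_mult_right integrable_real_indicator)
          (auto simp: emeasure_eq_measure)
    qed (use pt in \<open>auto simp: ic\<close>)
    also have "\<dots> = r / 2 + 2 * prob (A n)"
      by (subst Bochner_Integration.integral_add)
        (auto simp: emeasure_eq_measure prob_space intro!: integrable_mult_right integrable_real_indicator)
    also have "\<dots> < r" using n by simp
    finally show "norm (expectation (\<lambda>\<omega>. cos (X n \<omega>)) - expectation (\<lambda>\<omega>. cos (Z \<omega>))) < r" .
  qed
  then show "\<exists>no. \<forall>n\<ge>no. norm (expectation (\<lambda>\<omega>. cos (X n \<omega>)) - expectation (\<lambda>\<omega>. cos (Z \<omega>))) < r"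
    by (simp add: eventually_sequentially)
qed

text \<open>On a common grid the integral is a weighted sum of independent increments, so the
  characteristic functions multiply and the exponents add up to the integral of the power of the
  step function.\<close>

lemma (in prob_space) expectation_cos_step_integral:
  assumes L: "two_sided_sas_levy_process M \<alpha> \<sigma> L" and "0 < \<alpha>" "0 < \<sigma>" and \<phi>: "step_rep \<phi>"
  shows "expectation (\<lambda>\<omega>. cos (step_integral L \<phi> \<omega>))
    = exp (- (\<sigma> powr \<alpha>) * enn2real (\<integral>\<^sup>+s. ennreal (\<bar>step_fun \<phi> s\<bar> powr \<alpha>) \<partial>lborel))"
proof -
  obtain m t where t: "strict_mono_on {..m::nat} t"
    and P: "\<forall>(c, a, b) \<in> set \<phi>. a \<in> t ` {..m} \<and> b \<in> t ` {..m} \<and> a \<le> b"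
    using step_rep_refinement[OF \<phi>] by blast
  define d where "d i = step_fun \<phi> (t (Suc i))" for i
  define D where "D i \<omega> = L (t (Suc i)) \<omega> - L (t i) \<omega>" for i \<omega>
  have [measurable]: "L t \<in> borel_measurable M" for t
    using L by (auto simp: two_sided_sas_levy_process_def two_sided_levy_process_def)
  have [measurable]: "D i \<in> borel_measurable M" for i by (simp add: D_def[abs_def])
  have "indep_vars (\<lambda>_. borel) D {..<m}"
    using L t unfolding two_sided_sas_levy_process_def two_sided_levy_process_def D_def by blast
  then have ind: "indep_vars (\<lambda>_. borel) (\<lambda>i \<omega>. d i * D i \<omega>) {..<m}"
    by (rule indep_vars_compose2) auto
  have inc: "t i < t (Suc i)" if "i < m" for i
    using strict_mono_onD[OF t, of i "Suc i"] that by force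
  have ch: "char (distr M borel (\<lambda>\<omega>. d i * D i \<omega>)) 1
      = of_real (exp (- (\<sigma> powr \<alpha>) * (\<bar>d i\<bar> powr \<alpha> * (t (Suc i) - t i))))" if "i < m" for i
  proof -
    have "char (distr M borel (\<lambda>\<omega>. d i * D i \<omega>)) 1 = char (distr M borel (D i)) (d i)"
      by (simp add: char_def integral_distr)
    also have "\<dots> = of_real (exp (- ((\<sigma> * (t (Suc i) - t i) powr (1 / \<alpha>)) powr \<alpha>) * \<bar>d i\<bar> powr \<alpha>))"
      using L inc[OF that] unfolding two_sided_sas_levy_process_def sas_distributed_def D_def by blast
    \<comment> \<open>The scale exponent \<open>1 / \<alpha>\<close> makes the characteristic
      exponent linear in the length of the cell.\<close>
    also have "(\<sigma> * (t (Suc i) - t i) powr (1 / \<alpha>)) powr \<alpha> = \<sigma> powr \<alpha> * (t (Suc i) - t i)"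
      using assms inc[OF that] by (simp add: powr_mult powr_powr)
    finally show ?thesis by (simp add: mult_ac)
  qed
  have si: "step_integral L \<phi> \<omega> = (\<Sum>i<m. d i * D i \<omega>)" for \<omega>
    unfolding step_integral_def d_def D_def by (rule step_sum_refine[OF t P])
  have "expectation (\<lambda>\<omega>. cos (step_integral L \<phi> \<omega>))
      = Re (char (distr M borel (\<lambda>\<omega>. \<Sum>i<m. d i * D i \<omega>)) 1)"
    using expectation_cos_eq_Re_char[of "\<lambda>\<omega>. \<Sum>i<m. d i * D i \<omega>" 1] by (simp add: si)
  also have "\<dots> = Re (\<Prod>i<m. of_real (exp (- (\<sigma> powr \<alpha>) * (\<bar>d i\<bar> powr \<alpha> * (t (Suc i) - t i)))))"
    by (simp add: char_distr_sum[OF ind] ch)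
  also have "\<dots> = exp (- (\<sigma> powr \<alpha>) * (\<Sum>i<m. \<bar>d i\<bar> powr \<alpha> * (t (Suc i) - t i)))"
    by (simp only: of_real_prod[symmetric] Re_complex_of_real sum_distrib_left exp_sum finite_lessThan)
  also have "(\<Sum>i<m. \<bar>d i\<bar> powr \<alpha> * (t (Suc i) - t i))
      = enn2real (\<integral>\<^sup>+s. ennreal (\<bar>step_fun \<phi> s\<bar> powr \<alpha>) \<partial>lborel)"
    using inc by (subst nn_integral_step_fun_powr[OF t \<open>0 < \<alpha>\<close> P])
       (auto simp: d_def less_imp_le intro!: enn2real_ennreal[symmetric] sum_nonneg)
  finally show ?thesis .
qed

lemma step_integral_measurable:
  assumes [measurable]: "\<And>t. L t \<in> borel_measurable M"
  shows "step_integral L \<phi> \<in> borel_measurable M"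
  unfolding step_integral_def[abs_def] by (induction \<phi>) (auto simp: case_prod_beta)

text \<open>Both sides of the formula for step functions pass to the limit, the left by convergence
  in probability and the right by continuity of the L^\<alpha> functional. Finiteness is stated
  separately because \<open>enn2real\<close> sends an infinite integral to 0.\<close>

lemma (in prob_space) expectation_cos_stable_integral:
  assumes L: "two_sided_sas_levy_process M \<alpha> \<sigma> L" and "0 < \<alpha>" "0 < \<sigma>"
    and X: "is_stable_integral M L \<alpha> f X"
  shows "(\<integral>\<^sup>+s. ennreal (\<bar>f s\<bar> powr \<alpha>) \<partial>lborel) < \<infinity>"
    and "expectation (\<lambda>\<omega>. cos (X \<omega>))
      = exp (- (\<sigma> powr \<alpha>) * enn2real (\<integral>\<^sup>+s. ennreal (\<bar>f s\<bar> powr \<alpha>) \<partial>lborel))"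
proof -
  from X obtain \<phi> where [measurable]: "f \<in> borel_measurable borel" "X \<in> borel_measurable M"
    and rep: "\<And>n. step_rep (\<phi> n)"
    and lim: "(\<lambda>n. \<integral>\<^sup>+ s. ennreal (\<bar>step_fun (\<phi> n) s - f s\<bar> powr \<alpha>) \<partial>lborel) \<longlonglongrightarrow> 0"
    and prb: "tendsto_in_prob M (\<lambda>n. step_integral L (\<phi> n)) X"
    unfolding is_stable_integral_def by blast
  have [measurable]: "step_integral L \<psi> \<in> borel_measurable M" for \<psi>
    using L by (intro step_integral_measurable)
      (auto simp: two_sided_sas_levy_process_def two_sided_levy_process_def)
  have fin: "(\<integral>\<^sup>+ s. ennreal (\<bar>step_fun (\<phi> n) s\<bar> powr \<alpha>) \<partial>lborel) < \<infinity>" for n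
  proof -
    obtain m t where t: "strict_mono_on {..m::nat} t"
      and P: "\<forall>(c, a, b) \<in> set (\<phi> n). a \<in> t ` {..m} \<and> b \<in> t ` {..m} \<and> a \<le> b"
      using step_rep_refinement[OF rep] by blast
    show ?thesis by (simp only: nn_integral_step_fun_powr[OF t \<open>0 < \<alpha>\<close> P] infinity_ennreal_def ennreal_less_top)
  qed
  have meas: "f \<in> borel_measurable lborel" "\<And>n. step_fun (\<phi> n) \<in> borel_measurable lborel" by auto
  note lims = tendsto_nn_integral_powr[OF meas \<open>0 < \<alpha>\<close> lim fin]
  show "(\<integral>\<^sup>+s. ennreal (\<bar>f s\<bar> powr \<alpha>) \<partial>lborel) < \<infinity>" by (rule lims(1))
  have "(\<lambda>n. expectation (\<lambda>\<omega>. cos (step_integral L (\<phi> n) \<omega>))) \<longlonglongrightarrow>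
     exp (- (\<sigma> powr \<alpha>) * enn2real (\<integral>\<^sup>+s. ennreal (\<bar>f s\<bar> powr \<alpha>) \<partial>lborel))"
    unfolding expectation_cos_step_integral[OF L assms(2,3) rep]
    by (intro tendsto_intros lims(2))
  moreover have "(\<lambda>n. expectation (\<lambda>\<omega>. cos (step_integral L (\<phi> n) \<omega>))) \<longlonglongrightarrow> expectation (\<lambda>\<omega>. cos (X \<omega>))"
    by (rule tendsto_expectation_cos[OF _ _ prb]) auto
  ultimately show "expectation (\<lambda>\<omega>. cos (X \<omega>))
      = exp (- (\<sigma> powr \<alpha>) * enn2real (\<integral>\<^sup>+s. ennreal (\<bar>f s\<bar> powr \<alpha>) \<partial>lborel))"
    by (rule LIMSEQ_unique[rotated])
qed

section \<open>Linearity of the stable integral\<close>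

lemma is_stable_integral_zero:
  assumes "prob_space M"
  shows "is_stable_integral M L \<alpha> (\<lambda>_. 0) (\<lambda>_. 0)"
  unfolding is_stable_integral_def
  by (intro conjI exI[of _ "\<lambda>_. []"])
    (auto simp: step_rep_def step_fun_def step_integral_def[abs_def] tendsto_in_prob_def)

lemma is_stable_integral_cmult:
  assumes "0 < \<alpha>" and X: "is_stable_integral M L \<alpha> f X"
  shows "is_stable_integral M L \<alpha> (\<lambda>s. k * f s) (\<lambda>\<omega>. k * X \<omega>)"
proof -
  from X obtain \<phi> where [measurable]: "f \<in> borel_measurable borel" "X \<in> borel_measurable M"
    and rep: "\<And>n. step_rep (\<phi> n)"
    and lim: "(\<lambda>n. \<integral>\<^sup>+ s. ennreal (\<bar>step_fun (\<phi> n) s - f s\<bar> powr \<alpha>) \<partial>lborel) \<longlonglongrightarrow> 0"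
    and prb: "tendsto_in_prob M (\<lambda>n. step_integral L (\<phi> n)) X"
    unfolding is_stable_integral_def by blast
  define \<psi> where "\<psi> n = map (\<lambda>(c, a, b). (k * c, a, b)) (\<phi> n)" for n
  have sf: "step_fun (\<psi> n) s = k * step_fun (\<phi> n) s" for n s
    by (simp add: step_fun_def \<psi>_def sum_list_const_mult[symmetric] case_prod_beta o_def mult_ac)
  have si: "step_integral L (\<psi> n) \<omega> = k * step_integral L (\<phi> n) \<omega>" for n \<omega>
    by (simp add: step_integral_def \<psi>_def sum_list_const_mult[symmetric] case_prod_beta o_def mult_ac)
  have "(\<integral>\<^sup>+ s. ennreal (\<bar>step_fun (\<psi> n) s - k * f s\<bar> powr \<alpha>) \<partial>lborel)
     = ennreal (\<bar>k\<bar> powr \<alpha>) * (\<integral>\<^sup>+ s. ennreal (\<bar>step_fun (\<phi> n) s - f s\<bar> powr \<alpha>) \<partial>lborel)" for n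
    by (subst nn_integral_cmult[symmetric])
      (auto simp: sf right_diff_distrib[symmetric] abs_mult powr_mult ennreal_mult)
  moreover have "(\<lambda>n. ennreal (\<bar>k\<bar> powr \<alpha>) * (\<integral>\<^sup>+ s. ennreal (\<bar>step_fun (\<phi> n) s - f s\<bar> powr \<alpha>) \<partial>lborel))
      \<longlonglongrightarrow> ennreal (\<bar>k\<bar> powr \<alpha>) * 0"
    by (intro ennreal_tendsto_cmult lim) auto
  ultimately have 1: "(\<lambda>n. \<integral>\<^sup>+ s. ennreal (\<bar>step_fun (\<psi> n) s - k * f s\<bar> powr \<alpha>) \<partial>lborel) \<longlonglongrightarrow> 0"
    by simp
  have 2: "tendsto_in_prob M (\<lambda>n. step_integral L (\<psi> n)) (\<lambda>\<omega>. k * X \<omega>)"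
    unfolding tendsto_in_prob_def
  proof (intro allI impI)
    fix \<epsilon> :: real assume "0 < \<epsilon>"
    show "(\<lambda>n. measure M {\<omega> \<in> space M. \<bar>step_integral L (\<psi> n) \<omega> - k * X \<omega>\<bar> > \<epsilon>}) \<longlonglongrightarrow> 0"
    \<comment> \<open>The event is rescaled by dividing by the absolute value of \<open>k\<close>;
      for \<open>k = 0\<close> both variables vanish identically.\<close>
    proof (cases "k = 0")
      case False
      have "\<epsilon> < \<bar>step_integral L (\<psi> n) \<omega> - k * X \<omega>\<bar> \<longleftrightarrow> \<epsilon> / \<bar>k\<bar> < \<bar>step_integral L (\<phi> n) \<omega> - X \<omega>\<bar>" for n \<omega>
        using False by (simp add: si right_diff_distrib[symmetric] abs_mult divide_less_eq mult_ac)
      then show ?thesis using prb False \<open>0 < \<epsilon>\<close> by (simp add: tendsto_in_prob_def)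
    qed (use \<open>0 < \<epsilon>\<close> in \<open>simp add: si\<close>)
  qed
  show ?thesis
    unfolding is_stable_integral_def
  proof (intro conjI exI[of _ \<psi>] allI 1 2)
    show "step_rep (\<psi> n)" for n using rep[of n] by (auto simp: step_rep_def \<psi>_def)
  qed auto
qed

text \<open>Approximating lists are concatenated, which is legitimate since the intervals of a
  representation may overlap. The L^\<alpha> error is bounded by the power inequality with \<eta> =
  1, the error in probability by splitting \<epsilon> into halves.\<close>

lemma is_stable_integral_add:
  assumes "prob_space M" and "0 < \<alpha>" and L: "\<And>t. L t \<in> borel_measurable M"
    and X: "is_stable_integral M L \<alpha> f X" and Y: "is_stable_integral M L \<alpha> g Y"
  shows "is_stable_integral M L \<alpha> (\<lambda>s. f s + g s) (\<lambda>\<omega>. X \<omega> + Y \<omega>)"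
proof -
  interpret prob_space M by fact
  note [measurable] = step_integral_measurable[OF L]
  from X obtain \<phi> where [measurable]: "f \<in> borel_measurable borel" "X \<in> borel_measurable M"
    and rep: "\<And>n. step_rep (\<phi> n)"
    and lim: "(\<lambda>n. \<integral>\<^sup>+ s. ennreal (\<bar>step_fun (\<phi> n) s - f s\<bar> powr \<alpha>) \<partial>lborel) \<longlonglongrightarrow> 0"
    and prb: "tendsto_in_prob M (\<lambda>n. step_integral L (\<phi> n)) X"
    unfolding is_stable_integral_def by blast
  from Y obtain \<psi> where [measurable]: "g \<in> borel_measurable borel" "Y \<in> borel_measurable M"
    and rep': "\<And>n. step_rep (\<psi> n)"
    and lim': "(\<lambda>n. \<integral>\<^sup>+ s. ennreal (\<bar>step_fun (\<psi> n) s - g s\<bar> powr \<alpha>) \<partial>lborel) \<longlonglongrightarrow> 0"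
    and prb': "tendsto_in_prob M (\<lambda>n. step_integral L (\<psi> n)) Y"
    unfolding is_stable_integral_def by blast
  define \<xi> where "\<xi> n = \<phi> n @ \<psi> n" for n
  have sf: "step_fun (\<xi> n) s = step_fun (\<phi> n) s + step_fun (\<psi> n) s" for n s
    by (simp add: step_fun_def \<xi>_def)
  have si: "step_integral L (\<xi> n) \<omega> = step_integral L (\<phi> n) \<omega> + step_integral L (\<psi> n) \<omega>" for n \<omega>
    by (simp add: step_integral_def \<xi>_def)
  have 1: "(\<lambda>n. \<integral>\<^sup>+ s. ennreal (\<bar>step_fun (\<xi> n) s - (f s + g s)\<bar> powr \<alpha>) \<partial>lborel) \<longlonglongrightarrow> 0"
  proof (rule tendsto_sandwich[OF _ _ tendsto_const])
    have eq: "step_fun (\<xi> n) s - (f s + g s) = (step_fun (\<phi> n) s - f s) + (step_fun (\<psi> n) s - g s)" for n s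
      by (simp add: sf)
    show "\<forall>\<^sub>F n in sequentially. (\<integral>\<^sup>+ s. ennreal (\<bar>step_fun (\<xi> n) s - (f s + g s)\<bar> powr \<alpha>) \<partial>lborel)
      \<le> ennreal ((1 + 1) powr \<alpha>) * (\<integral>\<^sup>+ s. ennreal (\<bar>step_fun (\<phi> n) s - f s\<bar> powr \<alpha>) \<partial>lborel)
      + ennreal ((1 + 1 / 1) powr \<alpha>) * (\<integral>\<^sup>+ s. ennreal (\<bar>step_fun (\<psi> n) s - g s\<bar> powr \<alpha>) \<partial>lborel)"
      unfolding eq using \<open>0 < \<alpha>\<close> by (intro always_eventually allI nn_integral_abs_add_powr_le) auto
    have "(\<lambda>n. ennreal ((1 + 1) powr \<alpha>) * (\<integral>\<^sup>+ s. ennreal (\<bar>step_fun (\<phi> n) s - f s\<bar> powr \<alpha>) \<partial>lborel)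
      + ennreal ((1 + 1 / 1) powr \<alpha>) * (\<integral>\<^sup>+ s. ennreal (\<bar>step_fun (\<psi> n) s - g s\<bar> powr \<alpha>) \<partial>lborel))
      \<longlonglongrightarrow> ennreal ((1 + 1) powr \<alpha>) * 0 + ennreal ((1 + 1 / 1) powr \<alpha>) * 0"
      by (intro tendsto_add ennreal_tendsto_cmult lim lim') auto
    then show "(\<lambda>n. ennreal ((1 + 1) powr \<alpha>) * (\<integral>\<^sup>+ s. ennreal (\<bar>step_fun (\<phi> n) s - f s\<bar> powr \<alpha>) \<partial>lborel)
      + ennreal ((1 + 1 / 1) powr \<alpha>) * (\<integral>\<^sup>+ s. ennreal (\<bar>step_fun (\<psi> n) s - g s\<bar> powr \<alpha>) \<partial>lborel))
      \<longlonglongrightarrow> 0" by simp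
  qed auto
  have 2: "tendsto_in_prob M (\<lambda>n. step_integral L (\<xi> n)) (\<lambda>\<omega>. X \<omega> + Y \<omega>)"
    unfolding tendsto_in_prob_def
  proof (intro allI impI)
    fix \<epsilon> :: real assume e: "0 < \<epsilon>"
    define A where "A n = {\<omega> \<in> space M. \<bar>step_integral L (\<phi> n) \<omega> - X \<omega>\<bar> > \<epsilon> / 2}" for n
    define B where "B n = {\<omega> \<in> space M. \<bar>step_integral L (\<psi> n) \<omega> - Y \<omega>\<bar> > \<epsilon> / 2}" for n
    have [measurable]: "A n \<in> sets M" "B n \<in> sets M" for n by (simp_all add: A_def B_def)
    have "(\<lambda>n. prob (A n) + prob (B n)) \<longlonglongrightarrow> 0 + 0"
      using prb prb' half_gt_zero[OF e] unfolding tendsto_in_prob_def A_def B_def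
      by (intro tendsto_add) blast+
    then have *: "(\<lambda>n. prob (A n) + prob (B n)) \<longlonglongrightarrow> 0" by simp
    show "(\<lambda>n. prob {\<omega> \<in> space M. \<bar>step_integral L (\<xi> n) \<omega> - (X \<omega> + Y \<omega>)\<bar> > \<epsilon>}) \<longlonglongrightarrow> 0"
    proof (rule tendsto_sandwich[OF _ _ tendsto_const *])
      have "prob {\<omega> \<in> space M. \<bar>step_integral L (\<xi> n) \<omega> - (X \<omega> + Y \<omega>)\<bar> > \<epsilon>} \<le> prob (A n \<union> B n)" for n
      proof (intro finite_measure_mono subsetI)
        fix \<omega>
        have "\<epsilon> < \<bar>a + b - (c + d)\<bar> \<Longrightarrow> \<epsilon> / 2 < \<bar>a - c\<bar> \<or> \<epsilon> / 2 < \<bar>b - d\<bar>" for a b c d :: real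
          by linarith
        moreover assume "\<omega> \<in> {\<omega> \<in> space M. \<bar>step_integral L (\<xi> n) \<omega> - (X \<omega> + Y \<omega>)\<bar> > \<epsilon>}"
        ultimately show "\<omega> \<in> A n \<union> B n" unfolding A_def B_def si by blast
      qed simp
      also have "prob (A n \<union> B n) \<le> prob (A n) + prob (B n)" for n
        by (intro measure_Un_le) auto
      finally show "\<forall>\<^sub>F n in sequentially. prob {\<omega> \<in> space M. \<bar>step_integral L (\<xi> n) \<omega> - (X \<omega> + Y \<omega>)\<bar> > \<epsilon>} \<le> prob (A n) + prob (B n)"
        by (intro always_eventually allI)
    qed auto
  qed
  show ?thesis
    unfolding is_stable_integral_def
  proof (intro conjI exI[of _ \<xi>] allI 1 2)
    show "step_rep (\<xi> n)" for n using rep[of n] rep'[of n] by (auto simp: step_rep_def \<xi>_def)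
  qed auto
qed

lemma is_stable_integral_sum:
  assumes "prob_space M" and "0 < \<alpha>" and L: "\<And>t. L t \<in> borel_measurable M"
    and X: "\<And>i. i \<in> I \<Longrightarrow> is_stable_integral M L \<alpha> (f i) (X i)"
  shows "is_stable_integral M L \<alpha> (\<lambda>s. \<Sum>i\<in>I. f i s) (\<lambda>\<omega>. \<Sum>i\<in>I. X i \<omega>)"
  using X
proof (induction I rule: infinite_finite_induct)
  case (insert i I)
  then show ?case by (simp add: is_stable_integral_add[OF assms(1-3)])
qed (simp_all add: is_stable_integral_zero[OF assms(1)])

section \<open>The Whittle function of an Ornstein-Uhlenbeck family\<close>

text \<open>Orthogonality of the characters in real form: multiplication by
  \<open>2 * sin (x / 2)\<close> makes the sum telescope, and the two boundary terms agree because
  their arguments differ by a multiple of the period.\<close>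

lemma sum_cos_fourier_freq:
  fixes h :: int
  assumes "1 \<le> n" "\<bar>h\<bar> < 2 * int n"
  shows "(\<Sum>j = - int n + 1..int n. cos (of_int h * fourier_freq n j)) = (if h = 0 then 2 * real n else 0)"
proof (cases "h = 0")
  case True
  then show ?thesis by simp
next
  case False
  define x where "x = pi * of_int h / real n"
  \<comment> \<open>The shift by one half makes consecutive differences of \<open>F\<close> equal to
    \<open>2 * sin (x / 2)\<close> times the summand.\<close>
  define F where "F i = sin ((real i - real n + 1 / 2) * x)" for i :: nat
  have "(\<Sum>j = - int n + 1..int n. cos (of_int h * fourier_freq n j)) = (\<Sum>j = - int n + 1..int n. cos (of_int j * x))"
    by (intro sum.cong refl) (simp add: x_def fourier_freq_def mult_ac)
  also have "\<dots> = (\<Sum>i<2 * n. cos ((real i - real n + 1) * x))"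
    by (rule sum.reindex_bij_witness[of _ "\<lambda>i. int i - int n + 1" "\<lambda>j. nat (j + int n - 1)"]) auto
  finally have eq: "(\<Sum>j = - int n + 1..int n. cos (of_int h * fourier_freq n j))
    = (\<Sum>i<2 * n. cos ((real i - real n + 1) * x))" .
  have "2 * sin (x / 2) * (\<Sum>i<2 * n. cos ((real i - real n + 1) * x)) = (\<Sum>i<2 * n. F (Suc i) - F i)"
    unfolding sum_distrib_left
  proof (intro sum.cong refl)
    fix i
    have "F (Suc i) - F i = sin ((real i - real n + 1) * x + x / 2) - sin ((real i - real n + 1) * x - x / 2)"
      by (simp add: F_def algebra_simps)
    then show "2 * sin (x / 2) * cos ((real i - real n + 1) * x) = F (Suc i) - F i"
      by (simp add: sin_add sin_diff)
  qed
  also have "\<dots> = F (2 * n) - F 0" by (rule sum_lessThan_telescope)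
  also have "F (2 * n) = sin (x / 2 + pi * of_int h)"
    using assms by (simp add: F_def x_def field_simps)
  also have "F 0 = sin (x / 2 - pi * of_int h)"
    using assms by (simp add: F_def x_def field_simps)
  also have "sin (x / 2 + pi * of_int h) - sin (x / 2 - pi * of_int h) = 0"
    by (simp add: sin_add sin_diff sin_times_pi_eq_0 mult.commute[of pi])
  finally have "sin (x / 2) * (\<Sum>i<2 * n. cos ((real i - real n + 1) * x)) = 0" by simp
  moreover have "sin (x / 2) \<noteq> 0"
  proof -
    \<comment> \<open>The strict bound on the lag puts \<open>x / 2\<close> strictly between
      \<open>- pi\<close> and \<open>pi\<close>; as it is nonzero, the multiplier can be
      cancelled.\<close>
    have "real_of_int \<bar>h\<bar> < 2 * real n" using assms(2) by linarith
    then have "\<bar>x / 2\<bar> < pi" using assms(1) by (simp add: x_def abs_mult field_simps)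
    moreover have "x / 2 \<noteq> 0" using False assms(1) by (simp add: x_def)
    ultimately show ?thesis by (simp add: sin_zero_pi_iff)
  qed
  ultimately show ?thesis using False eq by simp
qed

lemma cmod_one_minus_power2:
  "(cmod (1 - complex_of_real c * exp (\<i> * complex_of_real w)))\<^sup>2 = 1 + c\<^sup>2 - 2 * c * cos w"
proof -
  have "(cmod (1 - complex_of_real c * exp (\<i> * complex_of_real w)))\<^sup>2 = (1 - c * cos w)\<^sup>2 + (c * sin w)\<^sup>2"
    by (simp add: cmod_power2 Re_exp Im_exp)
  also have "\<dots> = 1 + c\<^sup>2 * ((sin w)\<^sup>2 + (cos w)\<^sup>2) - 2 * c * cos w"
    by algebra
  finally show ?thesis by simp
qed

lemma cmod_trig_sum_power2:
  fixes y :: "nat \<Rightarrow> real"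
  shows "(cmod (\<Sum>k\<in>K. complex_of_real (y k) * exp (\<i> * of_nat k * complex_of_real w)))\<^sup>2
    = (\<Sum>k\<in>K. \<Sum>l\<in>K. y k * y l * cos (of_int (int k - int l) * w))"
proof -
  have e: "\<i> * of_nat k * complex_of_real w = \<i> * complex_of_real (real k * w)" for k by simp
  have "(cmod (\<Sum>k\<in>K. complex_of_real (y k) * exp (\<i> * of_nat k * complex_of_real w)))\<^sup>2
     = (\<Sum>k\<in>K. y k * cos (real k * w))\<^sup>2 + (\<Sum>k\<in>K. y k * sin (real k * w))\<^sup>2"
    unfolding e cmod_power2 Re_sum Im_sum by (simp add: Re_exp Im_exp)
  also have "\<dots> = (\<Sum>k\<in>K. \<Sum>l\<in>K. y k * y l * (cos (real k * w) * cos (real l * w) + sin (real k * w) * sin (real l * w)))"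
    unfolding power2_eq_square sum_product sum.distrib[symmetric]
    by (intro sum.cong refl) (simp add: algebra_simps)
  also have "\<dots> = (\<Sum>k\<in>K. \<Sum>l\<in>K. y k * y l * cos (of_int (int k - int l) * w))"
    by (simp add: cos_diff[symmetric] left_diff_distrib)
  finally show ?thesis .
qed

text \<open>The squared modulus of the transfer function contains the lags 0 and 1 only, so its
  product with the periodogram involves \<open>k - l\<close> and its two neighbours. These are at
  most \<open>n\<close> in absolute value, hence below \<open>2 * n\<close>, and no aliasing occurs:
  the diagonal and the two adjacent diagonals survive.\<close>

lemma whittle_fun_eq:
  fixes y :: "nat \<Rightarrow> real"
  assumes n: "1 \<le> n"
  shows "whittle_fun \<alpha> \<Delta> y n \<theta> = 1 / real n powr (2 / \<alpha>) *
    ((1 + (exp (\<theta> * \<Delta>))\<^sup>2) * (\<Sum>k=1..n. (y k)\<^sup>2) - 2 * exp (\<theta> * \<Delta>) * (\<Sum>k=1..<n. y k * y (Suc k)))"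
proof -
  define c where "c = exp (\<theta> * \<Delta>)"
  define w where "w = fourier_freq n"
  define D where "D h = (\<Sum>j = - int n + 1..int n. cos (of_int h * w j))" for h :: int
  have D: "D h = (if h = 0 then 2 * real n else 0)" if "\<bar>h\<bar> \<le> int n" for h
    unfolding D_def w_def using that n by (intro sum_cos_fourier_freq) auto
  have "(\<Sum>j = - int n + 1..int n. (cmod (ou_Pi \<Delta> (exp (\<i> * complex_of_real (w j))) \<theta>))\<^sup>2 * periodogram y n (w j))
    = (\<Sum>j = - int n + 1..int n. \<Sum>k=1..n. \<Sum>l=1..n. 1 / (2 * pi * real n) * (y k * y l) *
        ((1 + c\<^sup>2) * cos (of_int (int k - int l) * w j)
          - c * (cos (of_int (int k - int l + 1) * w j) + cos (of_int (int k - int l - 1) * w j))))"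
  proof (intro sum.cong refl)
    fix j
    have "(1 + c\<^sup>2 - 2 * c * cos v) * cos (of_int h * v)
      = (1 + c\<^sup>2) * cos (of_int h * v) - c * (cos (of_int (h + 1) * v) + cos (of_int (h - 1) * v))" for h v
      by (simp add: cos_add cos_diff distrib_right left_diff_distrib)
    then have *: "a * cos (of_int h * v) * (1 + c\<^sup>2 - 2 * c * cos v)
      = a * ((1 + c\<^sup>2) * cos (of_int h * v) - c * (cos (of_int (h + 1) * v) + cos (of_int (h - 1) * v)))" for a h v
      by (simp add: mult_ac)
    show "(cmod (ou_Pi \<Delta> (exp (\<i> * complex_of_real (w j))) \<theta>))\<^sup>2 * periodogram y n (w j)
      = (\<Sum>k=1..n. \<Sum>l=1..n. 1 / (2 * pi * real n) * (y k * y l) *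
        ((1 + c\<^sup>2) * cos (of_int (int k - int l) * w j)
          - c * (cos (of_int (int k - int l + 1) * w j) + cos (of_int (int k - int l - 1) * w j))))"
      unfolding ou_Pi_def periodogram_def cmod_one_minus_power2 cmod_trig_sum_power2 c_def[symmetric]
      unfolding *[symmetric] sum_distrib_left
      by (intro sum.cong refl) (simp add: mult_ac)
  qed
  also have "\<dots> = (\<Sum>k=1..n. \<Sum>l=1..n. 1 / (2 * pi * real n) * (y k * y l) *
        ((1 + c\<^sup>2) * D (int k - int l) - c * (D (int k - int l + 1) + D (int k - int l - 1))))"
    unfolding D_def sum_distrib_left sum.distrib[symmetric] sum_subtractf[symmetric]
    by (subst sum.swap, intro sum.cong refl, subst sum.swap, intro sum.cong refl)
  \<comment> \<open>Each surviving sum over frequencies equals \<open>2 * n\<close> and cancels the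
    normalisation of the periodogram; the remaining \<open>1 / pi\<close> later cancels the factor
    \<open>pi\<close> of \<open>whittle_fun\<close>.\<close>
  also have "\<dots> = (\<Sum>k=1..n. \<Sum>l=1..n. 1 / pi * (y k * y l) *
        ((1 + c\<^sup>2) * (if l = k then 1 else 0) - c * ((if l = Suc k then 1 else 0) + (if k = Suc l then 1 else 0))))"
    using n by (intro sum.cong refl) (auto simp: D field_simps)
  also have "\<dots> = 1 / pi * ((1 + c\<^sup>2) * (\<Sum>k=1..n. \<Sum>l=1..n. if l = k then y k * y l else 0)
      - c * ((\<Sum>k=1..n. \<Sum>l=1..n. if l = Suc k then y k * y l else 0) + (\<Sum>k=1..n. \<Sum>l=1..n. if k = Suc l then y k * y l else 0)))"
    unfolding sum_distrib_left sum.distrib[symmetric] sum_subtractf[symmetric]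
    by (intro sum.cong refl) (auto simp: algebra_simps)
  also have "(\<Sum>k=1..n. \<Sum>l=1..n. if l = k then y k * y l else 0) = (\<Sum>k=1..n. (y k)\<^sup>2)"
    by (simp add: power2_eq_square sum.delta)
  also have sh: "(\<Sum>k=1..n. \<Sum>l=1..n. if l = Suc k then y k * y l else 0) = (\<Sum>k=1..<n. y k * y (Suc k))"
    by (auto simp: sum.delta intro!: sum.mono_neutral_cong_right)
  \<comment> \<open>Lag -1 is lag 1 with the two indices exchanged, whence the factor 2 in the
    claim.\<close>
  also have "(\<Sum>k=1..n. \<Sum>l=1..n. if k = Suc l then y k * y l else 0) = (\<Sum>k=1..<n. y k * y (Suc k))"
    unfolding sh[symmetric] by (subst sum.swap) (simp add: mult.commute cong: if_cong)
  finally show ?thesis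
    unfolding whittle_fun_def w_def c_def by simp
qed

text \<open>The Whittle function is quadratic in \<open>exp (\<theta> * \<Delta>)\<close>. Comparing
  its minimal value with the value at \<open>\<theta>\<^sub>0\<close> gives a quadratic inequality
  for the difference of the exponentials, from which one factor is cancelled.\<close>

lemma whittle_arg_min_bound:
  fixes y :: "nat \<Rightarrow> real"
  assumes n: "1 \<le> n" and "\<theta>\<^sub>0 \<in> \<Theta>"
    and "is_arg_min (whittle_fun \<alpha> \<Delta> y n) (\<lambda>\<theta>. \<theta> \<in> \<Theta>) \<theta>"
  shows "(\<Sum>k=1..n. (y k)\<^sup>2) * \<bar>exp (\<theta> * \<Delta>) - exp (\<theta>\<^sub>0 * \<Delta>)\<bar>
    \<le> 2 * \<bar>(\<Sum>k=1..<n. y k * y (Suc k)) - exp (\<theta>\<^sub>0 * \<Delta>) * (\<Sum>k=1..n. (y k)\<^sup>2)\<bar>"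
proof -
  define S where "S = (\<Sum>k=1..n. (y k)\<^sup>2)"
  define C where "C = (\<Sum>k=1..<n. y k * y (Suc k))"
  define a where "a = exp (\<theta> * \<Delta>)"
  define b where "b = exp (\<theta>\<^sub>0 * \<Delta>)"
  have "whittle_fun \<alpha> \<Delta> y n \<theta> \<le> whittle_fun \<alpha> \<Delta> y n \<theta>\<^sub>0"
    using assms by (auto simp: is_arg_min_def not_less)
  moreover have "0 < 1 / real n powr (2 / \<alpha>)" using n by simp
  ultimately have "(1 + a\<^sup>2) * S - 2 * a * C \<le> (1 + b\<^sup>2) * S - 2 * b * C"
    unfolding whittle_fun_eq[OF n] S_def C_def a_def b_def by (rule mult_left_le_imp_le)
  \<comment> \<open>Subtracting \<open>2 * b * S * (a - b)\<close> from both sides completes the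
    square.\<close>
  then have "S * (a - b)\<^sup>2 \<le> 2 * (C - b * S) * (a - b)"
    by (simp add: power2_eq_square algebra_simps)
  also have "\<dots> \<le> 2 * \<bar>C - b * S\<bar> * \<bar>a - b\<bar>"
    unfolding mult.assoc abs_mult[symmetric] by (intro mult_left_mono abs_ge_self) simp
  finally have "(S * \<bar>a - b\<bar>) * \<bar>a - b\<bar> \<le> (2 * \<bar>C - b * S\<bar>) * \<bar>a - b\<bar>"
    by (simp add: power2_eq_square mult.assoc)
  \<comment> \<open>For \<open>a = b\<close> the left side is 0; otherwise a positive factor is
    cancelled.\<close>
  then have "S * \<bar>a - b\<bar> \<le> 2 * \<bar>C - b * S\<bar>"
    by (cases "a = b") auto
  then show ?thesis by (simp add: S_def C_def a_def b_def)
qed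

text \<open>This turns a lower bound for the squared innovations into one for the squared
  observations. Each residual obeys
  \<open>(u - v)\<^sup>2 \<le> 2 * u\<^sup>2 + 2 * v\<^sup>2\<close>, and each square occurs at most
  twice.\<close>

lemma sum_power2_residual_le:
  fixes y :: "nat \<Rightarrow> real"
  assumes "\<bar>c\<bar> \<le> 1"
  shows "(\<Sum>k=1..<n. (y (Suc k) - c * y k)\<^sup>2) \<le> 4 * (\<Sum>k=1..n. (y k)\<^sup>2)"
proof -
  have c2: "c\<^sup>2 \<le> 1" using assms by (simp add: abs_square_le_1)
  have "(y (Suc k) - c * y k)\<^sup>2 \<le> 2 * (y (Suc k))\<^sup>2 + 2 * (y k)\<^sup>2" for k
  proof -
    have "0 \<le> (y (Suc k) + c * y k)\<^sup>2" by simp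
    moreover have "c\<^sup>2 * (y k)\<^sup>2 \<le> 1 * (y k)\<^sup>2" using c2 by (intro mult_right_mono) auto
    ultimately show ?thesis by (simp add: power2_eq_square algebra_simps)
  qed
  then have "(\<Sum>k=1..<n. (y (Suc k) - c * y k)\<^sup>2) \<le> (\<Sum>k=1..<n. 2 * (y (Suc k))\<^sup>2 + 2 * (y k)\<^sup>2)"
    by (rule sum_mono)
  also have "\<dots> = 2 * (\<Sum>k\<in>Suc ` {1..<n}. (y k)\<^sup>2) + 2 * (\<Sum>k=1..<n. (y k)\<^sup>2)"
    by (subst sum.reindex) (auto simp: sum.distrib sum_distrib_left)
  also have "\<dots> \<le> 2 * (\<Sum>k=1..n. (y k)\<^sup>2) + 2 * (\<Sum>k=1..n. (y k)\<^sup>2)"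
    by (intro add_mono mult_left_mono sum_mono2) auto
  finally show ?thesis by simp
qed

text \<open>The last square has no successor among the lag products, which leaves the boundary term
  at \<open>n\<close>.\<close>

lemma lag_product_residual:
  fixes y :: "nat \<Rightarrow> real"
  assumes "1 \<le> n"
  shows "(\<Sum>k=1..<n. y k * y (Suc k)) - c * (\<Sum>k=1..n. (y k)\<^sup>2)
    = (\<Sum>k=1..<n. y k * (y (Suc k) - c * y k)) - c * (y n)\<^sup>2"
proof -
  have "{1..n} = insert n {1..<n}" using assms by auto
  then show ?thesis
    by (simp add: algebra_simps sum_subtractf sum_distrib_left power2_eq_square)
qed

lemma abs_sum_powr_disjoint:
  fixes h :: "'i \<Rightarrow> real"
  assumes "finite I" "\<And>i j. i \<in> I \<Longrightarrow> j \<in> I \<Longrightarrow> i \<noteq> j \<Longrightarrow> h i = 0 \<or> h j = 0"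
  shows "\<bar>\<Sum>i\<in>I. h i\<bar> powr \<alpha> = (\<Sum>i\<in>I. \<bar>h i\<bar> powr \<alpha>)"
proof (cases "\<forall>i\<in>I. h i = 0")
  case False
  then obtain i where i: "i \<in> I" "h i \<noteq> 0" by blast
  then have "h j = 0" if "j \<in> I - {i}" for j using assms(2)[of i j] that by auto
  then show ?thesis using assms(1) i(1) by (simp add: sum.remove)
qed simp

section \<open>Fractional moments\<close>

text \<open>Near 0 the integrand is at most \<open>A * t powr (\<alpha> - 1 - p)\<close>, integrable
  since \<open>p < \<alpha>\<close>; beyond 1 it is at most \<open>t powr (- 1 - p)\<close>,
  integrable since \<open>0 < p\<close>.\<close>

lemma nn_integral_one_minus_exp_powr_finite:
  fixes A p \<alpha> :: real
  assumes "0 \<le> A" "0 < p" "p < \<alpha>"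
  shows "(\<integral>\<^sup>+t. ennreal (indicator {0<..} t * (1 - exp (- A * \<bar>t\<bar> powr \<alpha>)) * t powr (- 1 - p)) \<partial>lborel) < \<infinity>"
proof -
  have "(\<integral>\<^sup>+t. ennreal (indicator {0<..} t * (1 - exp (- A * \<bar>t\<bar> powr \<alpha>)) * t powr (- 1 - p)) \<partial>lborel)
     \<le> (\<integral>\<^sup>+t. ennreal A * ennreal (indicator {0..1} t * t powr (\<alpha> - 1 - p))
          + ennreal (indicator {1..} t * t powr (- 1 - p)) \<partial>lborel)"
  proof (rule nn_integral_mono)
    fix t :: real
    have "indicator {0<..} t * (1 - exp (- A * \<bar>t\<bar> powr \<alpha>)) * t powr (- 1 - p)
      \<le> A * (indicator {0..1} t * t powr (\<alpha> - 1 - p)) + indicator {1..} t * t powr (- 1 - p)"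
    proof (cases "t \<le> 0 \<or> 1 \<le> t")
      case True
      then show ?thesis using assms
        by (auto simp: indicator_def intro!: mult_left_le_one_le add_increasing order_trans[of "- exp (- A)" 0 A])
    next
      case False
      have "1 - exp (- A * t powr \<alpha>) \<le> A * t powr \<alpha>"
        using exp_ge_add_one_self[of "- A * t powr \<alpha>"] by simp
      then have "(1 - exp (- A * t powr \<alpha>)) * t powr (- 1 - p) \<le> A * t powr \<alpha> * t powr (- 1 - p)"
        by (intro mult_right_mono) auto
      also have "\<dots> = A * t powr (\<alpha> - 1 - p)" using powr_add[of t \<alpha> "- 1 - p"] by (simp add: mult.assoc algebra_simps)
      finally show ?thesis using False by (simp add: indicator_def)
    qed
    then show "ennreal (indicator {0<..} t * (1 - exp (- A * \<bar>t\<bar> powr \<alpha>)) * t powr (- 1 - p))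
      \<le> ennreal A * ennreal (indicator {0..1} t * t powr (\<alpha> - 1 - p)) + ennreal (indicator {1..} t * t powr (- 1 - p))"
      using assms by (simp add: ennreal_mult[symmetric] ennreal_plus[symmetric] del: ennreal_plus)
  qed
  also have "\<dots> = ennreal A * (\<integral>\<^sup>+t. ennreal (indicator {0..1} t * t powr (\<alpha> - 1 - p)) \<partial>lborel)
      + (\<integral>\<^sup>+t. ennreal (indicator {1..} t * t powr (- 1 - p)) \<partial>lborel)"
    by (subst nn_integral_add) (auto simp: nn_integral_cmult)
  also have "(\<integral>\<^sup>+t. ennreal (indicator {0..1} t * t powr (\<alpha> - 1 - p)) \<partial>lborel)
      = ennreal (1 powr (\<alpha> - 1 - p + 1) / (\<alpha> - 1 - p + 1))"
    using assms by (intro nn_integral_has_integral_lebesgue has_integral_powr_from_0) auto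
  also have "(\<integral>\<^sup>+t. ennreal (indicator {1..} t * t powr (- 1 - p)) \<partial>lborel)
      = ennreal (-(1 powr (- 1 - p + 1)) / (- 1 - p + 1))"
    using assms by (intro nn_integral_has_integral_lebesgue has_integral_powr_to_inf) auto
  also have "ennreal A * ennreal (1 powr (\<alpha> - 1 - p + 1) / (\<alpha> - 1 - p + 1))
     + ennreal (-(1 powr (- 1 - p + 1)) / (- 1 - p + 1)) < \<infinity>"
    by (simp add: ennreal_mult_less_top)
  finally show ?thesis .
qed

text \<open>Only the range \<open>1 / \<bar>z\<bar> \<le> t \<le> 2 / \<bar>z\<bar>\<close> of the integral is used.\<close>

lemma abs_powr_le_nn_integral:
  fixes z p :: real
  assumes "0 < p"
  shows "ennreal ((1 - cos 1) * 2 powr (- 1 - p) * \<bar>z\<bar> powr p)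
    \<le> (\<integral>\<^sup>+t. ennreal (indicator {0<..} t * (1 - cos (t * z)) * t powr (- 1 - p)) \<partial>lborel)"
proof (cases "z = 0")
  case False
  \<comment> \<open>A lower bound for the integrand on the window, whose length is
    \<open>1 / \<bar>z\<bar>\<close>: there \<open>t * \<bar>z\<bar>\<close> lies between 1 and 2,
    where the cosine is at most \<open>cos 1\<close>, and the power of \<open>t\<close> is smallest
    at the right end.\<close>
  define K where "K = (1 - cos 1) * (2 / \<bar>z\<bar>) powr (- 1 - p)"
  have "0 \<le> K" by (simp add: K_def)
  have z: "0 < \<bar>z\<bar>" using False by simp
  have "K * (1 / \<bar>z\<bar>) = (1 - cos 1) * 2 powr (- 1 - p) * (\<bar>z\<bar> powr (1 + p) * \<bar>z\<bar> powr (- 1))"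
    using z by (simp add: K_def powr_divide powr_minus powr_diff powr_add field_simps)
  also have "\<bar>z\<bar> powr (1 + p) * \<bar>z\<bar> powr (- 1) = \<bar>z\<bar> powr p"
    using powr_add[of "\<bar>z\<bar>" "1 + p" "-1"] by simp
  finally have K: "(1 - cos 1) * 2 powr (- 1 - p) * \<bar>z\<bar> powr p = K * (1 / \<bar>z\<bar>)" by simp
  have "ennreal ((1 - cos 1) * 2 powr (- 1 - p) * \<bar>z\<bar> powr p)
      = ennreal K * emeasure lborel {1 / \<bar>z\<bar>..2 / \<bar>z\<bar>}"
    using z \<open>0 \<le> K\<close> unfolding K by (simp add: ennreal_mult[symmetric] divide_right_mono diff_divide_distrib[symmetric])
  also have "\<dots> = (\<integral>\<^sup>+t. ennreal K * indicator {1 / \<bar>z\<bar>..2 / \<bar>z\<bar>} t \<partial>lborel)"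
    by (subst nn_integral_cmult_indicator) auto
  also have "\<dots> \<le> (\<integral>\<^sup>+t. ennreal (indicator {0<..} t * (1 - cos (t * z)) * t powr (- 1 - p)) \<partial>lborel)"
  proof (rule nn_integral_mono)
    fix t :: real
    show "ennreal K * indicator {1 / \<bar>z\<bar>..2 / \<bar>z\<bar>} t
       \<le> ennreal (indicator {0<..} t * (1 - cos (t * z)) * t powr (- 1 - p))"
    proof (cases "t \<in> {1 / \<bar>z\<bar>..2 / \<bar>z\<bar>}")
      case True
      then have tz: "1 \<le> t * \<bar>z\<bar>" "t * \<bar>z\<bar> \<le> 2" using z by (auto simp: field_simps)
      have "0 < 1 / \<bar>z\<bar>" using z by simp
      with True have t: "0 < t" by (meson atLeastAtMost_iff less_le_trans)
      have "cos (t * z) = cos \<bar>t * z\<bar>" by simp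
      also have "\<dots> = cos (t * \<bar>z\<bar>)" using t by (simp add: abs_mult del: cos_abs_real)
      also have "\<dots> \<le> cos 1" using tz pi_gt3 by (intro cos_monotone_0_pi_le) auto
      finally have "1 - cos 1 \<le> 1 - cos (t * z)" by simp
      moreover have "(2 / \<bar>z\<bar>) powr (- 1 - p) \<le> t powr (- 1 - p)"
        using True t assms by (intro powr_mono2') auto
      ultimately have "K \<le> (1 - cos (t * z)) * t powr (- 1 - p)"
        unfolding K_def by (intro mult_mono) auto
      then show ?thesis using True t by (simp add: ennreal_leI)
    qed simp
  qed
  finally show ?thesis .
qed simp

text \<open>The cosine bound for the power is inserted and the integrals are exchanged by Tonelli.
  The weight \<open>G\<close> carries a second variable along, so that the estimate can be applied
  twice to a product moment.\<close>

lemma nn_integral_abs_powr_mult_le: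
  fixes X :: "'a \<Rightarrow> real" and G :: "'a \<Rightarrow> ennreal"
  assumes "sigma_finite_measure M" "0 < p"
    and [measurable]: "X \<in> borel_measurable M" "G \<in> borel_measurable M"
  shows "ennreal ((1 - cos 1) * 2 powr (- 1 - p)) * (\<integral>\<^sup>+\<omega>. ennreal (\<bar>X \<omega>\<bar> powr p) * G \<omega> \<partial>M)
    \<le> (\<integral>\<^sup>+t. ennreal (indicator {0<..} t * t powr (- 1 - p)) *
          (\<integral>\<^sup>+\<omega>. ennreal (1 - cos (t * X \<omega>)) * G \<omega> \<partial>M) \<partial>lborel)"
proof -
  interpret sigma_finite_measure M by fact
  interpret pair_sigma_finite lborel M ..
  have "ennreal ((1 - cos 1) * 2 powr (- 1 - p)) * (\<integral>\<^sup>+\<omega>. ennreal (\<bar>X \<omega>\<bar> powr p) * G \<omega> \<partial>M)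
     = (\<integral>\<^sup>+\<omega>. ennreal ((1 - cos 1) * 2 powr (- 1 - p) * \<bar>X \<omega>\<bar> powr p) * G \<omega> \<partial>M)"
    by (subst nn_integral_cmult[symmetric]) (auto simp: ennreal_mult mult.assoc)
  also have "\<dots> \<le> (\<integral>\<^sup>+\<omega>. (\<integral>\<^sup>+t. ennreal (indicator {0<..} t * (1 - cos (t * X \<omega>)) * t powr (- 1 - p)) \<partial>lborel) * G \<omega> \<partial>M)"
    by (intro nn_integral_mono mult_right_mono abs_powr_le_nn_integral assms) auto
  also have "\<dots> = (\<integral>\<^sup>+\<omega>. (\<integral>\<^sup>+t. ennreal (indicator {0<..} t * t powr (- 1 - p)) * (ennreal (1 - cos (t * X \<omega>)) * G \<omega>) \<partial>lborel) \<partial>M)"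
    by (subst nn_integral_multc[symmetric]) (auto simp: ennreal_mult[symmetric] mult_ac intro!: nn_integral_cong)
  also have "\<dots> = (\<integral>\<^sup>+t. (\<integral>\<^sup>+\<omega>. ennreal (indicator {0<..} t * t powr (- 1 - p)) * (ennreal (1 - cos (t * X \<omega>)) * G \<omega>) \<partial>M) \<partial>lborel)"
    by (rule Fubini') measurable
  also have "\<dots> = (\<integral>\<^sup>+t. ennreal (indicator {0<..} t * t powr (- 1 - p)) *
          (\<integral>\<^sup>+\<omega>. ennreal (1 - cos (t * X \<omega>)) * G \<omega> \<partial>M) \<partial>lborel)"
    by (subst nn_integral_cmult) auto
  finally show ?thesis .
qed

text \<open>An upper bound for the absolute moment of order \<open>p\<close> of a symmetric stable
  variable with characteristic function \<open>exp (- A * \<bar>t\<bar> powr \<alpha>)\<close>. The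
  denominator is the constant from the cosine bound for the power.\<close>

definition moment_bound :: "real \<Rightarrow> real \<Rightarrow> real \<Rightarrow> real" where
  "moment_bound p \<alpha> A =
    enn2real (\<integral>\<^sup>+t. ennreal (indicator {0<..} t * (1 - exp (- A * \<bar>t\<bar> powr \<alpha>)) * t powr (- 1 - p)) \<partial>lborel)
      / ((1 - cos 1) * 2 powr (- 1 - p))"

lemma (in prob_space) nn_integral_abs_powr_mult_stable:
  fixes X :: "'a \<Rightarrow> real" and G :: "'a \<Rightarrow> ennreal"
  assumes [measurable]: "X \<in> borel_measurable M" "G \<in> borel_measurable M"
    and "0 < p" "p < \<alpha>" "0 \<le> A"
    and X: "\<And>t. (\<integral>\<^sup>+\<omega>. ennreal (1 - cos (t * X \<omega>)) * G \<omega> \<partial>M) \<le> ennreal (1 - exp (- A * \<bar>t\<bar> powr \<alpha>)) * g"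
  shows "(\<integral>\<^sup>+\<omega>. ennreal (\<bar>X \<omega>\<bar> powr p) * G \<omega> \<partial>M) \<le> ennreal (moment_bound p \<alpha> A) * g"
proof -
  define \<kappa> :: real where "\<kappa> = (1 - cos 1) * 2 powr (- 1 - p)"
  \<comment> \<open>Strict monotonicity of the cosine makes the constant positive, so it can be
    divided out at the end.\<close>
  have "cos 1 < cos (0::real)" using pi_gt3 by (intro cos_monotone_0_pi) auto
  then have \<kappa>: "0 < \<kappa>" by (simp add: \<kappa>_def)
  define J where "J = (\<integral>\<^sup>+t. ennreal (indicator {0<..} t * (1 - exp (- A * \<bar>t\<bar> powr \<alpha>)) * t powr (- 1 - p)) \<partial>lborel)"
  \<comment> \<open>Finiteness ensures that \<open>enn2real\<close> does not replace the integral by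
    its default value 0.\<close>
  have J: "J = ennreal (enn2real J)"
    using nn_integral_one_minus_exp_powr_finite[OF assms(5,3,4)] by (simp add: J_def less_top)
  have "ennreal \<kappa> * (\<integral>\<^sup>+\<omega>. ennreal (\<bar>X \<omega>\<bar> powr p) * G \<omega> \<partial>M)
     \<le> (\<integral>\<^sup>+t. ennreal (indicator {0<..} t * t powr (- 1 - p)) *
          (\<integral>\<^sup>+\<omega>. ennreal (1 - cos (t * X \<omega>)) * G \<omega> \<partial>M) \<partial>lborel)"
    unfolding \<kappa>_def by (rule nn_integral_abs_powr_mult_le[OF sigma_finite_measure_axioms assms(3,1,2)])
  also have "\<dots> \<le> (\<integral>\<^sup>+t. ennreal (indicator {0<..} t * t powr (- 1 - p)) * (ennreal (1 - exp (- A * \<bar>t\<bar> powr \<alpha>)) * g) \<partial>lborel)"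
    by (intro nn_integral_mono mult_left_mono X) auto
  also have "\<dots> = (\<integral>\<^sup>+t. ennreal (indicator {0<..} t * (1 - exp (- A * \<bar>t\<bar> powr \<alpha>)) * t powr (- 1 - p)) * g \<partial>lborel)"
  proof (intro nn_integral_cong)
    fix t :: real
    have "ennreal (indicator {0<..} t * t powr (- 1 - p)) * ennreal (1 - exp (- A * \<bar>t\<bar> powr \<alpha>))
      = ennreal (indicator {0<..} t * (1 - exp (- A * \<bar>t\<bar> powr \<alpha>)) * t powr (- 1 - p))"
      using \<open>0 \<le> A\<close> by (subst ennreal_mult[symmetric]) (auto simp: mult_ac)
    then show "ennreal (indicator {0<..} t * t powr (- 1 - p)) * (ennreal (1 - exp (- A * \<bar>t\<bar> powr \<alpha>)) * g)
      = ennreal (indicator {0<..} t * (1 - exp (- A * \<bar>t\<bar> powr \<alpha>)) * t powr (- 1 - p)) * g"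
      by (simp only: mult.assoc[symmetric])
  qed
  also have "\<dots> = J * g" by (simp add: nn_integral_multc J_def)
  also have "J = ennreal \<kappa> * ennreal (moment_bound p \<alpha> A)"
  proof -
    have eq: "\<kappa> * moment_bound p \<alpha> A = enn2real J"
    proof -
      have "moment_bound p \<alpha> A = enn2real J / \<kappa>" by (simp only: moment_bound_def J_def \<kappa>_def)
      then show ?thesis using \<kappa> by simp
    qed
    have "ennreal \<kappa> * ennreal (moment_bound p \<alpha> A) = ennreal (\<kappa> * moment_bound p \<alpha> A)"
      using \<kappa> by (intro ennreal_mult[symmetric]) (auto simp: moment_bound_def)
    then show ?thesis unfolding eq J[symmetric] by (rule sym)
  qed
  finally have "ennreal \<kappa> * (\<integral>\<^sup>+\<omega>. ennreal (\<bar>X \<omega>\<bar> powr p) * G \<omega> \<partial>M) \<le> ennreal \<kappa> * (ennreal (moment_bound p \<alpha> A) * g)"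
    by (simp add: mult.assoc)
  then show ?thesis
    using \<kappa> by (subst (asm) ennreal_mult_le_mult_iff) auto
qed

text \<open>Factorisation of the joint cosine transform stands in for independence. The weighted
  estimate is applied to \<open>Y\<close> with weight \<open>1 - cos (s * X)\<close>, then to
  \<open>X\<close> with weight \<open>\<bar>Y\<bar> powr p\<close>.\<close>

lemma (in prob_space) nn_integral_abs_powr_mult_powr_stable:
  assumes [measurable]: "X \<in> borel_measurable M" "Y \<in> borel_measurable M"
    and p: "0 < p" "p < \<alpha>" and "0 \<le> A" "0 \<le> B"
    and ch: "\<And>s t. expectation (\<lambda>\<omega>. cos (s * X \<omega> + t * Y \<omega>)) = exp (- A * \<bar>s\<bar> powr \<alpha>) * exp (- B * \<bar>t\<bar> powr \<alpha>)"
  shows "(\<integral>\<^sup>+\<omega>. ennreal (\<bar>X \<omega>\<bar> powr p) * ennreal (\<bar>Y \<omega>\<bar> powr p) \<partial>M)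
      \<le> ennreal (moment_bound p \<alpha> A) * ennreal (moment_bound p \<alpha> B)"
    and "(\<integral>\<^sup>+\<omega>. ennreal (\<bar>X \<omega>\<bar> powr p) \<partial>M) \<le> ennreal (moment_bound p \<alpha> A)"
proof -
  have ic: "integrable M (\<lambda>\<omega>. cos (W \<omega>))" if [measurable]: "W \<in> borel_measurable M" for W :: "'a \<Rightarrow> real"
    by (rule integrable_const_bound[where B=1]) auto
  have cX: "expectation (\<lambda>\<omega>. cos (s * X \<omega>)) = exp (- A * \<bar>s\<bar> powr \<alpha>)" for s
    using ch[of s 0] by simp
  have cY: "expectation (\<lambda>\<omega>. cos (t * Y \<omega>)) = exp (- B * \<bar>t\<bar> powr \<alpha>)" for t
    using ch[of 0 t] by simp
  have "(\<integral>\<^sup>+\<omega>. ennreal (1 - cos (s * X \<omega>)) * ennreal (1 - cos (t * Y \<omega>)) \<partial>M)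
     = ennreal (1 - exp (- A * \<bar>s\<bar> powr \<alpha>)) * ennreal (1 - exp (- B * \<bar>t\<bar> powr \<alpha>))" for s t
  proof -
    \<comment> \<open>The product is expressed through cosines of linear combinations, the
      quantities governed by \<open>ch\<close>; the sign of \<open>t\<close> disappears in the
      absolute value.\<close>
    have e: "(1 - cos (s * X \<omega>)) * (1 - cos (t * Y \<omega>))
      = 1 - cos (s * X \<omega>) - cos (t * Y \<omega>) + (1 / 2) * (cos (s * X \<omega> + t * Y \<omega>) + cos (s * X \<omega> + (- t) * Y \<omega>))" for \<omega>
      by (simp add: cos_add cos_diff algebra_simps)
    have i: "integrable M (\<lambda>\<omega>. (1 - cos (s * X \<omega>)) * (1 - cos (t * Y \<omega>)))"
      unfolding e by (intro Bochner_Integration.integrable_add Bochner_Integration.integrable_diff integrable_mult_right ic) auto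
    have "(\<integral>\<^sup>+\<omega>. ennreal (1 - cos (s * X \<omega>)) * ennreal (1 - cos (t * Y \<omega>)) \<partial>M)
      = (\<integral>\<^sup>+\<omega>. ennreal ((1 - cos (s * X \<omega>)) * (1 - cos (t * Y \<omega>))) \<partial>M)"
      by (simp add: ennreal_mult)
    also have "\<dots> = ennreal (expectation (\<lambda>\<omega>. (1 - cos (s * X \<omega>)) * (1 - cos (t * Y \<omega>))))"
      by (rule nn_integral_eq_integral[OF i]) simp
    also have "expectation (\<lambda>\<omega>. (1 - cos (s * X \<omega>)) * (1 - cos (t * Y \<omega>)))
      = 1 - expectation (\<lambda>\<omega>. cos (s * X \<omega>)) - expectation (\<lambda>\<omega>. cos (t * Y \<omega>))
        + (1 / 2) * (expectation (\<lambda>\<omega>. cos (s * X \<omega> + t * Y \<omega>)) + expectation (\<lambda>\<omega>. cos (s * X \<omega> + (- t) * Y \<omega>)))"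
      unfolding e by (simp add: ic prob_space del: mult_minus_left)
    also have "\<dots> = (1 - exp (- A * \<bar>s\<bar> powr \<alpha>)) * (1 - exp (- B * \<bar>t\<bar> powr \<alpha>))"
      unfolding ch cX cY by (simp add: algebra_simps)
    finally show ?thesis using assms by (simp add: ennreal_mult)
  qed
  note prod = this
  have prod': "(\<integral>\<^sup>+\<omega>. ennreal (1 - cos (t * Y \<omega>)) * ennreal (1 - cos (s * X \<omega>)) \<partial>M)
     \<le> ennreal (1 - exp (- B * \<bar>t\<bar> powr \<alpha>)) * ennreal (1 - exp (- A * \<bar>s\<bar> powr \<alpha>))" for s t
    using prod[of s t] by (simp only: mult.commute order_refl)
  have Y: "(\<integral>\<^sup>+\<omega>. ennreal (\<bar>Y \<omega>\<bar> powr p) * ennreal (1 - cos (s * X \<omega>)) \<partial>M)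
     \<le> ennreal (moment_bound p \<alpha> B) * ennreal (1 - exp (- A * \<bar>s\<bar> powr \<alpha>))" for s
    by (intro nn_integral_abs_powr_mult_stable assms prod') measurable
  show "(\<integral>\<^sup>+\<omega>. ennreal (\<bar>X \<omega>\<bar> powr p) * ennreal (\<bar>Y \<omega>\<bar> powr p) \<partial>M)
      \<le> ennreal (moment_bound p \<alpha> A) * ennreal (moment_bound p \<alpha> B)"
  proof (intro nn_integral_abs_powr_mult_stable assms)
    show "(\<integral>\<^sup>+\<omega>. ennreal (1 - cos (s * X \<omega>)) * ennreal (\<bar>Y \<omega>\<bar> powr p) \<partial>M)
      \<le> ennreal (1 - exp (- A * \<bar>s\<bar> powr \<alpha>)) * ennreal (moment_bound p \<alpha> B)" for s
      using Y[of s] by (simp only: mult.commute)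
  qed measurable
  \<comment> \<open>The single moment is the case of constant weight 1.\<close>
  have "(\<integral>\<^sup>+\<omega>. ennreal (1 - cos (s * X \<omega>)) * 1 \<partial>M) \<le> ennreal (1 - exp (- A * \<bar>s\<bar> powr \<alpha>)) * 1" for s
    using nn_integral_eq_integral[of M "\<lambda>\<omega>. 1 - cos (s * X \<omega>)"] cX[of s] by (simp add: ic prob_space)
  then have "(\<integral>\<^sup>+\<omega>. ennreal (\<bar>X \<omega>\<bar> powr p) * 1 \<partial>M) \<le> ennreal (moment_bound p \<alpha> A) * 1"
    by (intro nn_integral_abs_powr_mult_stable assms) auto
  then show "(\<integral>\<^sup>+\<omega>. ennreal (\<bar>X \<omega>\<bar> powr p) \<partial>M) \<le> ennreal (moment_bound p \<alpha> A)" by simp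
qed

section \<open>Sums of squares and consistency\<close>

lemma one_plus_cos_half_bounds:
  "0 \<le> (1 + cos x) / 2" "(1 + cos x) / 2 \<le> (1::real)"
proof -
  have "-1 \<le> y \<Longrightarrow> y \<le> 1 \<Longrightarrow> 0 \<le> (1 + y) / 2 \<and> (1 + y) / 2 \<le> 1" for y :: real by simp
  from this[OF cos_ge_minus_one cos_le_one]
  show "0 \<le> (1 + cos x) / 2" "(1 + cos x) / 2 \<le> 1" by blast+
qed

text \<open>Induction on \<open>F\<close>. The additional cosine factor is the strengthening that
  makes it work: expanding the factor of a new index moves this index from the product into the
  linear combination, with coefficient \<open>t\<close> or \<open>- t\<close>.\<close>

lemma (in prob_space) expectation_prod_cos:
  fixes Z :: "'i \<Rightarrow> 'a \<Rightarrow> real" and \<phi> :: "real \<Rightarrow> real"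
  assumes [measurable]: "\<And>k. Z k \<in> borel_measurable M"
    and ch: "\<And>G v. finite G \<Longrightarrow> G \<subseteq> I \<Longrightarrow> expectation (\<lambda>\<omega>. cos (\<Sum>k\<in>G. v k * Z k \<omega>)) = (\<Prod>k\<in>G. \<phi> (v k))"
    and even: "\<phi> (- t) = \<phi> t"
    and "finite F" "finite G" "F \<subseteq> I" "G \<subseteq> I" "F \<inter> G = {}"
  shows "expectation (\<lambda>\<omega>. (\<Prod>k\<in>F. (1 + cos (t * Z k \<omega>)) / 2) * cos (\<Sum>k\<in>G. v k * Z k \<omega>))
    = ((1 + \<phi> t) / 2) ^ card F * (\<Prod>k\<in>G. \<phi> (v k))"
  using assms(4-8)
proof (induction F arbitrary: G v rule: finite_induct)
  case empty
  then show ?case by (simp add: ch)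
next
  case (insert j F)
  define P where "P \<omega> = (\<Prod>k\<in>F. (1 + cos (t * Z k \<omega>)) / 2)" for \<omega>
  define W where "W \<omega> = (\<Sum>k\<in>G. v k * Z k \<omega>)" for \<omega>
  have [measurable]: "P \<in> borel_measurable M" "W \<in> borel_measurable M"
    unfolding P_def[abs_def] W_def[abs_def] by auto
  have P: "0 \<le> P \<omega>" "P \<omega> \<le> 1" for \<omega>
    unfolding P_def by (intro prod_nonneg prod_le_1 ballI conjI one_plus_cos_half_bounds)+
  have i: "integrable M (\<lambda>\<omega>. P \<omega> * cos (V \<omega>))" if [measurable]: "V \<in> borel_measurable M" for V :: "'a \<Rightarrow> real"
    using P by (intro integrable_const_bound[where B=1]) (auto simp: abs_mult intro!: mult_le_one)
  have j: "j \<notin> G" "j \<notin> F" using insert by auto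
  \<comment> \<open>The updated coefficient function appends the index \<open>j\<close> with
    coefficient \<open>r\<close>, used below for \<open>t\<close> and \<open>- t\<close>.\<close>
  have "cos (\<Sum>k\<in>insert j G. (v(j := r)) k * Z k \<omega>) = cos (W \<omega> + r * Z j \<omega>)" for r \<omega>
  proof -
    have "(\<Sum>k\<in>G. (v(j := r)) k * Z k \<omega>) = W \<omega>"
      unfolding W_def using j by (intro sum.cong) auto
    then show ?thesis using j insert.prems by (simp add: add.commute)
  qed
  moreover have "(\<Prod>k\<in>insert j G. \<phi> ((v(j := r)) k)) = \<phi> r * (\<Prod>k\<in>G. \<phi> (v k))" for r
  proof -
    have "(\<Prod>k\<in>G. \<phi> ((v(j := r)) k)) = (\<Prod>k\<in>G. \<phi> (v k))" using j by (intro prod.cong) auto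
    then show ?thesis using j insert.prems by simp
  qed
  ultimately have IH: "expectation (\<lambda>\<omega>. P \<omega> * cos (W \<omega> + r * Z j \<omega>)) = ((1 + \<phi> t) / 2) ^ card F * (\<phi> r * (\<Prod>k\<in>G. \<phi> (v k)))" for r
    using insert.IH[of "insert j G" "v(j := r)"] insert.prems insert.hyps unfolding P_def by auto
  have IH0: "expectation (\<lambda>\<omega>. P \<omega> * cos (W \<omega>)) = ((1 + \<phi> t) / 2) ^ card F * (\<Prod>k\<in>G. \<phi> (v k))"
    using insert.IH[of G v] insert.prems unfolding P_def W_def by auto
  have "(\<Prod>k\<in>insert j F. (1 + cos (t * Z k \<omega>)) / 2) * cos (\<Sum>k\<in>G. v k * Z k \<omega>)
    = (1 / 2) * (P \<omega> * cos (W \<omega>)) + (1 / 4) * (P \<omega> * cos (W \<omega> + t * Z j \<omega>)) + (1 / 4) * (P \<omega> * cos (W \<omega> + (- t) * Z j \<omega>))" for \<omega>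
    using insert.hyps by (simp add: cos_add cos_diff P_def[symmetric] W_def[symmetric] algebra_simps)
  then have "expectation (\<lambda>\<omega>. (\<Prod>k\<in>insert j F. (1 + cos (t * Z k \<omega>)) / 2) * cos (\<Sum>k\<in>G. v k * Z k \<omega>))
    = (1 / 2) * expectation (\<lambda>\<omega>. P \<omega> * cos (W \<omega>)) + (1 / 4) * expectation (\<lambda>\<omega>. P \<omega> * cos (W \<omega> + t * Z j \<omega>))
      + (1 / 4) * expectation (\<lambda>\<omega>. P \<omega> * cos (W \<omega> + (- t) * Z j \<omega>))"
    by (simp add: i del: mult_minus_left)
  also have "\<dots> = ((1 + \<phi> t) / 2) ^ card (insert j F) * (\<Prod>k\<in>G. \<phi> (v k))"
    unfolding IH IH0 even using insert.hyps by (simp add: algebra_simps)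
  finally show ?case .
qed

text \<open>On the event in question \<open>\<Prod> (1 + cos (t Z\<^sub>k)) / 2 = \<Prod> (1 - sin\<^sup>2 (t Z\<^sub>k / 2)) \<ge> 1 - 1 / 4\<close>.\<close>

lemma (in prob_space) prob_sum_power2_le:
  fixes Z :: "'i \<Rightarrow> 'a \<Rightarrow> real" and \<phi> :: "real \<Rightarrow> real"
  assumes [measurable]: "\<And>k. Z k \<in> borel_measurable M"
    and ch: "\<And>G v. finite G \<Longrightarrow> G \<subseteq> I \<Longrightarrow> expectation (\<lambda>\<omega>. cos (\<Sum>k\<in>G. v k * Z k \<omega>)) = (\<Prod>k\<in>G. \<phi> (v k))"
    and even: "\<phi> (- t) = \<phi> t"
    and F: "finite F" "F \<subseteq> I"
  shows "prob {\<omega> \<in> space M. t\<^sup>2 * (\<Sum>k\<in>F. (Z k \<omega>)\<^sup>2) \<le> 1} \<le> 4 / 3 * ((1 + \<phi> t) / 2) ^ card F"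
proof -
  define A where "A = {\<omega> \<in> space M. t\<^sup>2 * (\<Sum>k\<in>F. (Z k \<omega>)\<^sup>2) \<le> 1}"
  have [measurable]: "A \<in> sets M" by (simp add: A_def)
  define P where "P \<omega> = (\<Prod>k\<in>F. (1 + cos (t * Z k \<omega>)) / 2)" for \<omega>
  have [measurable]: "P \<in> borel_measurable M"
    unfolding P_def[abs_def] by auto
  have P: "0 \<le> P \<omega>" "P \<omega> \<le> 1" for \<omega>
    unfolding P_def by (intro prod_nonneg prod_le_1 ballI conjI one_plus_cos_half_bounds)+
  \<comment> \<open>Taking expectations in this pointwise bound yields the constant
    \<open>4 / 3\<close>.\<close>
  have "3 / 4 * indicator A \<omega> \<le> P \<omega>" for \<omega>
  proof (cases "\<omega> \<in> A")
    case True
    have c: "(1 + cos x) / 2 = 1 - (sin (x / 2))\<^sup>2" for x :: real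
      using cos_double_sin[of "x / 2"] by (simp add: field_simps)
    have s: "(sin (x / 2))\<^sup>2 \<le> x\<^sup>2 / 4" for x :: real
      using power_mono[OF abs_sin_x_le_abs_x[of "x / 2"], of 2] by (simp add: power_divide)
    have sum_s: "(\<Sum>k\<in>F. (sin (t * Z k \<omega> / 2))\<^sup>2) \<le> 1 / 4"
    proof -
      have "(\<Sum>k\<in>F. (sin (t * Z k \<omega> / 2))\<^sup>2) \<le> (\<Sum>k\<in>F. (t * Z k \<omega>)\<^sup>2 / 4)" by (intro sum_mono s)
      also have "\<dots> = t\<^sup>2 * (\<Sum>k\<in>F. (Z k \<omega>)\<^sup>2) / 4" by (simp add: power_mult_distrib sum_distrib_left sum_divide_distrib)
      finally show ?thesis using True by (simp add: A_def)
    qed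
    have "1 - (\<Sum>k\<in>F. (sin (t * Z k \<omega> / 2))\<^sup>2) \<le> (\<Prod>k\<in>F. 1 - (sin (t * Z k \<omega> / 2))\<^sup>2)"
      by (rule Weierstrass_prod_ineq) (auto simp: abs_square_le_1)
    then show ?thesis using sum_s True unfolding P_def c by simp
  qed (use P in simp)
  then have "expectation (\<lambda>\<omega>. 3 / 4 * indicator A \<omega>) \<le> expectation P"
    using P by (intro integral_mono integrable_const_bound[where B=1]) (auto simp: indicator_def)
  \<comment> \<open>For empty \<open>G\<close> the cosine factor is
    \<open>cos 0 = 1\<close>.\<close>
  moreover have "expectation P = ((1 + \<phi> t) / 2) ^ card F"
    using expectation_prod_cos[of Z I \<phi> t F "{}"] assms unfolding P_def by simp
  ultimately show ?thesis by (simp add: A_def)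
qed

text \<open>By \<open>1 + x \<le> exp x\<close> the power is at most
  \<open>exp ((n - 1) * x)\<close> with negative \<open>x\<close> of order
  \<open>n powr (- b)\<close>, where \<open>b = q * \<alpha> / 2 < 1\<close>; hence the exponent
  tends to minus infinity. The count \<open>n - 1\<close> is the number of residuals formed from
  \<open>n\<close> observations.\<close>

lemma stable_sum_power2_rate:
  fixes B q \<alpha> :: real
  assumes "0 < B" "0 < q" "0 < \<alpha>" "q * \<alpha> < 2"
  shows "(\<lambda>n. 4 / 3 * ((1 + exp (- B * \<bar>real n powr (- q / 2)\<bar> powr \<alpha>)) / 2) ^ (n - 1)) \<longlonglongrightarrow> 0"
proof -
  define b where "b = q * \<alpha> / 2"
  have b: "0 < b" "b < 1" using assms by (auto simp: b_def)
  have lim: "(\<lambda>n::nat. 4 / 3 * exp ((real n - 1) * ((exp (- B * real n powr (- b)) - 1) / 2))) \<longlonglongrightarrow> 0"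
    using b \<open>0 < B\<close> by real_asymp
  show ?thesis
  proof (rule tendsto_sandwich[OF _ _ tendsto_const lim])
    show "\<forall>\<^sub>F n in sequentially. 4 / 3 * ((1 + exp (- B * \<bar>real n powr (- q / 2)\<bar> powr \<alpha>)) / 2) ^ (n - 1)
      \<le> 4 / 3 * exp ((real n - 1) * ((exp (- B * real n powr (- b)) - 1) / 2))"
      using eventually_ge_at_top[of 1]
    proof eventually_elim
      case (elim n)
      define x where "x = (exp (- B * real n powr (- b)) - 1) / 2"
      have "(1 + exp (- B * \<bar>real n powr (- q / 2)\<bar> powr \<alpha>)) / 2 = 1 + x"
        by (simp add: x_def powr_powr b_def field_simps)
      moreover have "(1 + x) ^ (n - 1) \<le> exp x ^ (n - 1)"
        by (intro power_mono exp_ge_add_one_self) (simp add: x_def field_simps add_increasing)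
      moreover have "exp x ^ (n - 1) = exp ((real n - 1) * x)"
        using elim by (simp add: exp_of_nat_mult[symmetric] of_nat_diff)
      ultimately have "((1 + exp (- B * \<bar>real n powr (- q / 2)\<bar> powr \<alpha>)) / 2) ^ (n - 1) \<le> exp ((real n - 1) * x)"
        by (simp only:)
      then show ?case unfolding x_def by (intro mult_left_mono) auto
    qed
  qed (auto intro!: always_eventually)
qed

text \<open>The observation at index \<open>a\<close> integrates a kernel over times up to
  \<open>a * \<Delta>\<close>, and each residual one over its own later interval of length \<Delta>.
  Disjoint supports make the power of the combined kernel additive, so the transform factorises;
  translation invariance makes \<open>A\<close> and \<open>B\<close> independent of the
  index.\<close>

lemma (in prob_space) ou_expectation_cos:
  fixes L :: "real \<Rightarrow> 'a \<Rightarrow> real" and Y :: "real \<Rightarrow> 'a \<Rightarrow> real"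
  assumes L: "two_sided_sas_levy_process M \<alpha> \<sigma> L" and pos: "0 < \<alpha>" "0 < \<sigma>" "0 < \<Delta>"
    and Y: "\<And>t. 0 \<le> t \<Longrightarrow> is_stable_integral M L \<alpha> (\<lambda>s. indicator {..t} s * exp (\<theta> * (t - s))) (Y t)"
  obtains A B where "0 \<le> A" "0 < B"
    "\<And>a F u v. finite F \<Longrightarrow> F \<subseteq> {a..} \<Longrightarrow>
      expectation (\<lambda>\<omega>. cos (u * Y (real a * \<Delta>) \<omega>
        + (\<Sum>k\<in>F. v k * (Y (real (Suc k) * \<Delta>) \<omega> - exp (\<theta> * \<Delta>) * Y (real k * \<Delta>) \<omega>))))
      = exp (- A * \<bar>u\<bar> powr \<alpha>) * (\<Prod>k\<in>F. exp (- B * \<bar>v k\<bar> powr \<alpha>))"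
proof -
  have Lm: "L t \<in> borel_measurable M" for t
    using L by (auto simp: two_sided_sas_levy_process_def two_sided_levy_process_def)
  define f where "f t s = indicator {..t} s * exp (\<theta> * (t - s))" for t s :: real
  define g where "g k s = indicator {real k * \<Delta><..real (Suc k) * \<Delta>} s * exp (\<theta> * (real (Suc k) * \<Delta> - s))" for k s
  define Z where "Z k \<omega> = Y (real (Suc k) * \<Delta>) \<omega> - exp (\<theta> * \<Delta>) * Y (real k * \<Delta>) \<omega>" for k \<omega>
  have [measurable]: "f t \<in> borel_measurable borel" "g k \<in> borel_measurable borel" for t k
    unfolding f_def[abs_def] g_def[abs_def] by measurable
  have Yf: "is_stable_integral M L \<alpha> (f (real k * \<Delta>)) (Y (real k * \<Delta>))" for k
    unfolding f_def[abs_def] using pos by (intro Y) auto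
  have Zg: "is_stable_integral M L \<alpha> (g k) (Z k)" for k
  proof -
    have "is_stable_integral M L \<alpha>
        (\<lambda>s. f (real (Suc k) * \<Delta>) s + (- exp (\<theta> * \<Delta>)) * f (real k * \<Delta>) s)
        (\<lambda>\<omega>. Y (real (Suc k) * \<Delta>) \<omega> + (- exp (\<theta> * \<Delta>)) * Y (real k * \<Delta>) \<omega>)"
      using pos by (intro is_stable_integral_add is_stable_integral_cmult Yf Lm prob_space_axioms)
    moreover have "f (real (Suc k) * \<Delta>) s + (- exp (\<theta> * \<Delta>)) * f (real k * \<Delta>) s = g k s" for s
    proof -
      have "exp (\<theta> * \<Delta>) * exp (\<theta> * (real k * \<Delta> - s)) = exp (\<theta> * (real (Suc k) * \<Delta> - s))"
        by (simp add: exp_add[symmetric] algebra_simps)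
      moreover have "real k * \<Delta> \<le> real (Suc k) * \<Delta>" using pos by simp
      ultimately show ?thesis unfolding f_def g_def by (auto simp: indicator_def)
    qed
    ultimately show ?thesis by (simp add: Z_def[abs_def])
  qed
  define NI :: "(real \<Rightarrow> real) \<Rightarrow> ennreal" where "NI h = (\<integral>\<^sup>+s. ennreal (\<bar>h s\<bar> powr \<alpha>) \<partial>lborel)" for h
  note ch = expectation_cos_stable_integral[OF L pos(1,2), folded NI_def]
  have shift: "NI h = NI (\<lambda>s. h (t + s))" if [measurable]: "h \<in> borel_measurable borel" for h t
    unfolding NI_def using nn_integral_real_affine[of "\<lambda>s. ennreal (\<bar>h s\<bar> powr \<alpha>)" 1 t] by simp
  have NIf: "NI (f (real k * \<Delta>)) = NI (f 0)" for k
    by (subst shift[of _ "real k * \<Delta>"]) (auto simp: f_def indicator_def intro!: arg_cong[where f=NI])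
  have NIg: "NI (g k) = NI (g 0)" for k
    by (subst shift[of _ "real k * \<Delta>"])
      (auto simp: g_def indicator_def distrib_right intro!: arg_cong[where f=NI])
  have fin: "NI (f 0) < \<infinity>" "NI (g 0) < \<infinity>" using ch(1)[OF Yf[of 0]] ch(1)[OF Zg[of 0]] by simp_all
  \<comment> \<open>The kernel is at least \<open>exp (- \<bar>\<theta>\<bar> * \<Delta>)\<close> on
    the whole interval. The resulting strict positivity of \<open>B\<close> drives the decay in the
    sum-of-squares bound.\<close>
  have g0: "0 < NI (g 0)"
  proof -
    have "ennreal (exp (- \<bar>\<theta>\<bar> * \<Delta>) powr \<alpha>) * emeasure lborel {0<..\<Delta>} \<le> NI (g 0)"
      unfolding NI_def
    proof (subst nn_integral_cmult_indicator[symmetric], simp, intro nn_integral_mono)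
      fix s
      show "ennreal (exp (- \<bar>\<theta>\<bar> * \<Delta>) powr \<alpha>) * indicator {0<..\<Delta>} s \<le> ennreal (\<bar>g 0 s\<bar> powr \<alpha>)"
      proof (cases "s \<in> {0<..\<Delta>}")
        case True
        have "- \<theta> * (\<Delta> - s) \<le> \<bar>\<theta>\<bar> * \<Delta>" using True by (intro mult_mono) auto
        then have "exp (- \<bar>\<theta>\<bar> * \<Delta>) \<le> \<bar>g 0 s\<bar>" using True by (simp add: g_def)
        then show ?thesis using True pos by (auto intro!: ennreal_leI powr_mono2)
      qed simp
    qed
    moreover have "0 < ennreal (exp (- \<bar>\<theta>\<bar> * \<Delta>) powr \<alpha>) * emeasure lborel {0<..\<Delta>}"
      using pos by (simp add: ennreal_zero_less_mult_iff)
    ultimately show ?thesis by (rule less_le_trans[rotated])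
  qed
  define A where "A = \<sigma> powr \<alpha> * enn2real (NI (f 0))"
  define B where "B = \<sigma> powr \<alpha> * enn2real (NI (g 0))"
  show thesis
  proof (rule that[of A B])
    show "0 \<le> A" by (simp add: A_def)
    show "0 < B" using g0 fin pos by (simp add: B_def enn2real_positive_iff less_top)
    fix a :: nat and F :: "nat set" and u :: real and v :: "nat \<Rightarrow> real"
    assume F: "finite F" "F \<subseteq> {a..}"
    define h where "h s = u * f (real a * \<Delta>) s + (\<Sum>k\<in>F. v k * g k s)" for s
    have int: "is_stable_integral M L \<alpha> h (\<lambda>\<omega>. u * Y (real a * \<Delta>) \<omega> + (\<Sum>k\<in>F. v k * Z k \<omega>))"
      unfolding h_def[abs_def] using pos
      by (intro is_stable_integral_add is_stable_integral_sum is_stable_integral_cmult Yf Zg Lm prob_space_axioms)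
    have mono: "real i * \<Delta> \<le> real j * \<Delta>" if "i \<le> j" for i j using that pos by simp
    have disj: "v k * g k s = 0 \<or> v l * g l s = 0" if "k \<noteq> l" for k l s
    proof (cases "k < l")
      case True
      then show ?thesis using mono[of "Suc k" l] by (auto simp: g_def indicator_def)
    next
      case False
      then show ?thesis using that mono[of "Suc l" k] by (auto simp: g_def indicator_def)
    qed
    \<comment> \<open>The condition that \<open>F\<close> starts at \<open>a\<close> enters here:
      the observation kernel lives on times up to \<open>a * \<Delta>\<close>, the residual kernels
      strictly after.\<close>
    have "g k s = 0" if "k \<in> F" "f (real a * \<Delta>) s \<noteq> 0" for k s
      using that F mono[of a k] by (auto simp: f_def g_def indicator_def split: if_splits)
    then have disj': "f (real a * \<Delta>) s = 0 \<or> (\<Sum>k\<in>F. v k * g k s) = 0" for s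
      by (cases "f (real a * \<Delta>) s = 0") simp_all
    have pt: "\<bar>h s\<bar> powr \<alpha> = \<bar>u\<bar> powr \<alpha> * \<bar>f (real a * \<Delta>) s\<bar> powr \<alpha> + (\<Sum>k\<in>F. \<bar>v k\<bar> powr \<alpha> * \<bar>g k s\<bar> powr \<alpha>)" for s
    proof -
      have "\<bar>h s\<bar> powr \<alpha> = \<bar>u * f (real a * \<Delta>) s\<bar> powr \<alpha> + \<bar>\<Sum>k\<in>F. v k * g k s\<bar> powr \<alpha>"
        using disj'[of s] by (auto simp: h_def)
      also have "\<bar>\<Sum>k\<in>F. v k * g k s\<bar> powr \<alpha> = (\<Sum>k\<in>F. \<bar>v k * g k s\<bar> powr \<alpha>)"
        using F(1) disj by (rule abs_sum_powr_disjoint)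
      finally show ?thesis by (simp add: abs_mult powr_mult)
    qed
    have "NI h = (\<integral>\<^sup>+s. ennreal (\<bar>u\<bar> powr \<alpha>) * ennreal (\<bar>f (real a * \<Delta>) s\<bar> powr \<alpha>)
        + (\<Sum>k\<in>F. ennreal (\<bar>v k\<bar> powr \<alpha>) * ennreal (\<bar>g k s\<bar> powr \<alpha>)) \<partial>lborel)"
      unfolding NI_def pt
      by (intro nn_integral_cong)
        (simp only: ennreal_plus ennreal_mult sum_ennreal[symmetric] powr_ge_zero mult_nonneg_nonneg sum_nonneg)
    also have "\<dots> = ennreal (\<bar>u\<bar> powr \<alpha>) * NI (f (real a * \<Delta>)) + (\<Sum>k\<in>F. ennreal (\<bar>v k\<bar> powr \<alpha>) * NI (g k))"
      unfolding NI_def by (simp add: nn_integral_add nn_integral_cmult nn_integral_sum)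
    also have "\<dots> = ennreal (\<bar>u\<bar> powr \<alpha>) * NI (f 0) + (\<Sum>k\<in>F. ennreal (\<bar>v k\<bar> powr \<alpha>) * NI (g 0))"
      unfolding NIf by (intro arg_cong2[where f="(+)"] sum.cong refl arg_cong2[where f="(*)"] NIg)
    also have "\<dots> = ennreal (\<bar>u\<bar> powr \<alpha> * enn2real (NI (f 0)) + (\<Sum>k\<in>F. \<bar>v k\<bar> powr \<alpha> * enn2real (NI (g 0))))"
    proof -
      \<comment> \<open>Both integrals are finite, so the extended expression is the image of a real
        one.\<close>
      obtain x y where "NI (f 0) = ennreal x" "0 \<le> x" "NI (g 0) = ennreal y" "0 \<le> y"
        using fin by (auto simp: less_top_ennreal)
      moreover have "(\<Sum>k\<in>F. ennreal (\<bar>v k\<bar> powr \<alpha>) * ennreal y) = ennreal (\<Sum>k\<in>F. \<bar>v k\<bar> powr \<alpha> * y)" if "0 \<le> y" for y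
        using that by (simp only: ennreal_mult[symmetric] sum_ennreal powr_ge_zero mult_nonneg_nonneg)
      ultimately show ?thesis
        by (simp only: ennreal_mult ennreal_plus sum_nonneg powr_ge_zero mult_nonneg_nonneg enn2real_ennreal)
    qed
    finally have "enn2real (NI h) = \<bar>u\<bar> powr \<alpha> * enn2real (NI (f 0)) + (\<Sum>k\<in>F. \<bar>v k\<bar> powr \<alpha> * enn2real (NI (g 0)))"
      by (simp only: enn2real_ennreal add_nonneg_nonneg sum_nonneg mult_nonneg_nonneg powr_ge_zero enn2real_nonneg)
    then have "- (\<sigma> powr \<alpha>) * enn2real (NI h) = - A * \<bar>u\<bar> powr \<alpha> + (\<Sum>k\<in>F. - B * \<bar>v k\<bar> powr \<alpha>)"
      by (simp add: A_def B_def distrib_left sum_distrib_left sum_negf mult_ac)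
    then have "exp (- (\<sigma> powr \<alpha>) * enn2real (NI h)) = exp (- A * \<bar>u\<bar> powr \<alpha>) * (\<Prod>k\<in>F. exp (- B * \<bar>v k\<bar> powr \<alpha>))"
      using F(1) by (simp only: exp_add exp_sum)
    then show "expectation (\<lambda>\<omega>. cos (u * Y (real a * \<Delta>) \<omega>
        + (\<Sum>k\<in>F. v k * (Y (real (Suc k) * \<Delta>) \<omega> - exp (\<theta> * \<Delta>) * Y (real k * \<Delta>) \<omega>))))
      = exp (- A * \<bar>u\<bar> powr \<alpha>) * (\<Prod>k\<in>F. exp (- B * \<bar>v k\<bar> powr \<alpha>))"
      using ch(2)[OF int] by (simp add: Z_def)
  qed
qed

text \<open>For two terms, divide by \<open>s = \<bar>x\<bar> + \<bar>y\<bar>\<close>: the quotients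
  lie in the unit interval, where lowering the exponent from 1 to \<open>p\<close> increases the
  power.\<close>

lemma abs_sum_powr_le:
  fixes a :: "'i \<Rightarrow> real"
  assumes "0 < p" "p \<le> 1"
  shows "\<bar>\<Sum>i\<in>I. a i\<bar> powr p \<le> (\<Sum>i\<in>I. \<bar>a i\<bar> powr p)"
proof (induction I rule: infinite_finite_induct)
  case (insert i I)
  have "\<bar>x + y\<bar> powr p \<le> \<bar>x\<bar> powr p + \<bar>y\<bar> powr p" for x y :: real
  proof (cases "x = 0 \<and> y = 0")
    case False
    define s where "s = \<bar>x\<bar> + \<bar>y\<bar>"
    have s: "0 < s" using False by (auto simp: s_def)
    have *: "z / s \<le> (z / s) powr p" if "0 \<le> z" "z \<le> s" for z
      using powr_mono'[of p 1 "z / s"] that s assms by (cases "z = 0") auto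
    have "1 = \<bar>x\<bar> / s + \<bar>y\<bar> / s" using s by (simp add: s_def add_divide_distrib[symmetric])
    also have "\<dots> \<le> (\<bar>x\<bar> / s) powr p + (\<bar>y\<bar> / s) powr p"
      by (intro add_mono *) (auto simp: s_def)
    also have "\<dots> = (\<bar>x\<bar> powr p + \<bar>y\<bar> powr p) / s powr p"
      using s by (simp add: powr_divide add_divide_distrib)
    finally have "s powr p \<le> \<bar>x\<bar> powr p + \<bar>y\<bar> powr p" using s by (simp add: field_simps)
    moreover have "\<bar>x + y\<bar> powr p \<le> s powr p" using assms by (intro powr_mono2) (auto simp: s_def)
    ultimately show ?thesis by linarith
  qed simp
  from this[of "a i" "sum a I"] show ?case using insert by simp
qed auto

lemma (in prob_space) prob_powr_Markov:
  fixes X :: "'a \<Rightarrow> real"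
  assumes [measurable]: "X \<in> borel_measurable M" and "0 < p" "0 < r" "0 \<le> K"
    and K: "(\<integral>\<^sup>+\<omega>. ennreal (\<bar>X \<omega>\<bar> powr p) \<partial>M) \<le> ennreal K"
  shows "prob {\<omega> \<in> space M. r \<le> \<bar>X \<omega>\<bar>} \<le> K / r powr p"
proof -
  have "ennreal (prob {\<omega> \<in> space M. r \<le> \<bar>X \<omega>\<bar>}) = emeasure M {\<omega> \<in> space M. r \<le> \<bar>X \<omega>\<bar>}"
    by (simp add: emeasure_eq_measure)
  then have "ennreal (r powr p * prob {\<omega> \<in> space M. r \<le> \<bar>X \<omega>\<bar>})
      = (\<integral>\<^sup>+\<omega>. ennreal (r powr p) * indicator {\<omega> \<in> space M. r \<le> \<bar>X \<omega>\<bar>} \<omega> \<partial>M)"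
    by (simp add: nn_integral_cmult_indicator ennreal_mult)
  also have "\<dots> \<le> (\<integral>\<^sup>+\<omega>. ennreal (\<bar>X \<omega>\<bar> powr p) \<partial>M)"
    using assms(2,3) by (intro nn_integral_mono) (auto simp: indicator_def intro!: ennreal_leI powr_mono2)
  also note K
  finally have "r powr p * prob {\<omega> \<in> space M. r \<le> \<bar>X \<omega>\<bar>} \<le> K" using \<open>0 \<le> K\<close> by simp
  then show ?thesis using \<open>0 < r\<close> by (simp add: field_simps)
qed

text \<open>The choice \<open>\<alpha> / 2 < p\<close> leaves room for \<open>q\<close> between
  \<open>1 / p\<close> and \<open>2 / \<alpha>\<close>. Moments require \<open>p < \<alpha>\<close>,
  subadditivity uses \<open>p < 1\<close>, \<open>1 < q * p\<close> makes the cross term negligible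
  against \<open>n powr q\<close>, and \<open>q * \<alpha> < 2\<close> keeps \<open>n powr q\<close>
  below the sum of squared residuals.\<close>

lemma stable_rate_exponents:
  fixes \<alpha> :: real
  assumes "0 < \<alpha>" "\<alpha> < 2"
  obtains p q where "0 < p" "p < \<alpha>" "p < 1" "0 < q" "1 < q * p" "q * \<alpha> < 2"
proof -
  obtain p where p: "\<alpha> / 2 < p" "p < min \<alpha> 1" using dense[of "\<alpha> / 2" "min \<alpha> 1"] assms by auto
  have "1 / p < 2 / \<alpha>" using p assms by (simp add: field_simps)
  then obtain q where q: "1 / p < q" "q < 2 / \<alpha>" using dense by blast
  have p0: "0 < p" using p assms by linarith
  then have "0 < 1 / p" by simp
  then have "0 < q" using q by linarith
  show thesis
    using p q p0 \<open>0 < q\<close> assms by (intro that[of p q]) (auto simp: field_simps)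
qed

theorem theorem4p5:
  fixes M :: "'a measure"
    and L :: "real \<Rightarrow> 'a \<Rightarrow> real"
    and Y :: "real \<Rightarrow> real \<Rightarrow> 'a \<Rightarrow> real"
    and \<alpha> \<sigma> \<Delta> \<theta>\<^sub>0 :: real
    and \<Theta> :: "real set"
    and \<theta>\<^sub>h :: "nat \<Rightarrow> 'a \<Rightarrow> real"
  assumes "prob_space M"
    and "0 < \<alpha>" and "\<alpha> < 2" and "0 < \<sigma>" and "0 < \<Delta>"
    and "two_sided_sas_levy_process M \<alpha> \<sigma> L"
    and "compact \<Theta>" and "\<Theta> \<subseteq> {..<0}" and "\<theta>\<^sub>0 \<in> interior \<Theta>"
    and "sas_ou_family M L \<alpha> \<Theta> Y"
    and "whittle_estimator M \<alpha> \<Delta> \<Theta> (\<lambda>k. Y \<theta>\<^sub>0 (real k * \<Delta>)) \<theta>\<^sub>h"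
  shows "tendsto_in_prob M \<theta>\<^sub>h (\<lambda>_. \<theta>\<^sub>0)"
proof -
  interpret prob_space M by fact
  have \<theta>\<^sub>0: "\<theta>\<^sub>0 \<in> \<Theta>" "\<theta>\<^sub>0 < 0" using assms(8,9) interior_subset[of \<Theta>] by auto
  define c where "c = exp (\<theta>\<^sub>0 * \<Delta>)"
  have c: "0 < c" "c \<le> 1" using \<theta>\<^sub>0 assms(5) by (auto simp: c_def mult_le_0_iff)
  define y where "y k = Y \<theta>\<^sub>0 (real k * \<Delta>)" for k :: nat
  define Z where "Z k \<omega> = y (Suc k) \<omega> - c * y k \<omega>" for k \<omega>
  have Yint: "is_stable_integral M L \<alpha> (\<lambda>s. indicator {..t} s * exp (\<theta>\<^sub>0 * (t - s))) (Y \<theta>\<^sub>0 t)" if "0 \<le> t" for t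
    using assms(10) \<theta>\<^sub>0 that by (auto simp: sas_ou_family_def)
  have [measurable]: "y k \<in> borel_measurable M" for k
    using Yint[of "real k * \<Delta>"] assms(5) by (auto simp: y_def is_stable_integral_def)
  have [measurable]: "Z k \<in> borel_measurable M" for k unfolding Z_def[abs_def] by measurable
  obtain A B where AB: "0 \<le> A" "0 < B" and ch: "\<And>a F u v. finite F \<Longrightarrow> F \<subseteq> {a..} \<Longrightarrow>
      expectation (\<lambda>\<omega>. cos (u * y a \<omega> + (\<Sum>k\<in>F. v k * Z k \<omega>)))
      = exp (- A * \<bar>u\<bar> powr \<alpha>) * (\<Prod>k\<in>F. exp (- B * \<bar>v k\<bar> powr \<alpha>))"
    using ou_expectation_cos[OF assms(6,2,4,5) Yint] unfolding Z_def y_def c_def by blast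
  obtain p q where pq: "0 < p" "p < \<alpha>" "p < 1" "0 < q" "1 < q * p" "q * \<alpha> < 2"
    using stable_rate_exponents[OF assms(2,3)] by blast
  define Ky where "Ky = moment_bound p \<alpha> A"
  define Kz where "Kz = moment_bound p \<alpha> B"
  have K: "0 \<le> Ky" "0 \<le> Kz" by (simp_all add: Ky_def Kz_def moment_bound_def)
  \<comment> \<open>With \<open>F = {k}\<close> and \<open>a = k\<close> the residual
    \<open>Z k\<close> follows the observation \<open>y k\<close>, so their joint transform
    factorises.\<close>
  have joint: "expectation (\<lambda>\<omega>. cos (s * y k \<omega> + t * Z k \<omega>)) = exp (- A * \<bar>s\<bar> powr \<alpha>) * exp (- B * \<bar>t\<bar> powr \<alpha>)" for s t k
    using ch[of "{k}" k s "\<lambda>_. t"] by simp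
  note moments = nn_integral_abs_powr_mult_powr_stable[OF _ _ pq(1,2) AB(1) less_imp_le[OF AB(2)] joint]
  have mom_y: "(\<integral>\<^sup>+\<omega>. ennreal (\<bar>y k \<omega>\<bar> powr p) \<partial>M) \<le> ennreal Ky" for k
    unfolding Ky_def by (rule moments(2)[of k]) measurable
  have mom_yZ: "(\<integral>\<^sup>+\<omega>. ennreal (\<bar>y k \<omega> * Z k \<omega>\<bar> powr p) \<partial>M) \<le> ennreal (Ky * Kz)" for k
    using moments(1)[of k] K by (simp add: abs_mult powr_mult ennreal_mult Ky_def Kz_def)
  have mom_sum: "(\<integral>\<^sup>+\<omega>. ennreal (\<bar>\<Sum>k=1..<n. y k \<omega> * Z k \<omega>\<bar> powr p) \<partial>M) \<le> ennreal (real n * (Ky * Kz))" for n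
  proof -
    have "(\<integral>\<^sup>+\<omega>. ennreal (\<bar>\<Sum>k=1..<n. y k \<omega> * Z k \<omega>\<bar> powr p) \<partial>M)
       \<le> (\<integral>\<^sup>+\<omega>. (\<Sum>k=1..<n. ennreal (\<bar>y k \<omega> * Z k \<omega>\<bar> powr p)) \<partial>M)"
      using pq by (intro nn_integral_mono) (auto intro!: ennreal_leI abs_sum_powr_le)
    also have "\<dots> = (\<Sum>k=1..<n. \<integral>\<^sup>+\<omega>. ennreal (\<bar>y k \<omega> * Z k \<omega>\<bar> powr p) \<partial>M)"
      by (rule nn_integral_sum) measurable
    also have "\<dots> \<le> (\<Sum>k=1..<n. ennreal (Ky * Kz))" by (intro sum_mono mom_yZ)
    also have "\<dots> = ennreal (real (n - 1) * (Ky * Kz))" using K by (simp add: ennreal_mult ennreal_of_nat_eq_real_of_nat)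
    also have "\<dots> \<le> ennreal (real n * (Ky * Kz))" using K by (intro ennreal_leI mult_right_mono) auto
    finally show ?thesis .
  qed
  show ?thesis
    unfolding tendsto_in_prob_def
  proof (intro allI impI)
    fix \<epsilon> :: real assume \<epsilon>: "0 < \<epsilon>"
    \<comment> \<open>The separation of the exponentials when \<theta> is more than \<epsilon> from
      the true value. It is the gap on the left; the gap on the right is at least
      \<open>c * (exp (\<epsilon> * \<Delta>) - 1)\<close>, which is no smaller.\<close>
    define \<eta> where "\<eta> = c * (1 - exp (- \<epsilon> * \<Delta>))"
    have "exp (- \<epsilon> * \<Delta>) < 1" using \<epsilon> assms(5) by simp
    then have \<eta>: "0 < \<eta>" using c by (simp add: \<eta>_def)
    have sep: "\<eta> \<le> \<bar>exp (\<theta> * \<Delta>) - c\<bar>" if "\<bar>\<theta> - \<theta>\<^sub>0\<bar> > \<epsilon>" for \<theta>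
    proof (cases "\<theta> < \<theta>\<^sub>0")
      case True
      then have "\<theta> * \<Delta> \<le> (\<theta>\<^sub>0 - \<epsilon>) * \<Delta>" using that assms(5) by (intro mult_right_mono) auto
      then have "exp (\<theta> * \<Delta>) \<le> exp (\<theta>\<^sub>0 * \<Delta> + (- \<epsilon> * \<Delta>))" by (simp add: algebra_simps)
      then have "exp (\<theta> * \<Delta>) \<le> c * exp (- \<epsilon> * \<Delta>)" by (simp only: exp_add c_def)
      then show ?thesis unfolding \<eta>_def right_diff_distrib by linarith
    next
      case False
      then have "(\<theta>\<^sub>0 + \<epsilon>) * \<Delta> \<le> \<theta> * \<Delta>" using that assms(5) by (intro mult_right_mono) auto
      then have "c * exp (\<epsilon> * \<Delta>) \<le> exp (\<theta> * \<Delta>)" by (simp add: c_def exp_add[symmetric] algebra_simps)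
      moreover have "c * (1 - exp (- \<epsilon> * \<Delta>)) \<le> c * (exp (\<epsilon> * \<Delta>) - 1)"
      proof (rule mult_left_mono)
        have "1 - exp (- \<epsilon> * \<Delta>) \<le> \<epsilon> * \<Delta>" using exp_ge_add_one_self[of "- \<epsilon> * \<Delta>"] by simp
        also have "\<dots> \<le> exp (\<epsilon> * \<Delta>) - 1" using exp_ge_add_one_self[of "\<epsilon> * \<Delta>"] by linarith
        finally show "1 - exp (- \<epsilon> * \<Delta>) \<le> exp (\<epsilon> * \<Delta>) - 1" .
      qed (use c in simp)
      ultimately show ?thesis by (simp add: \<eta>_def algebra_simps)
    qed
    \<comment> \<open>The constant 16 fits the final contradiction: off \<open>E1\<close> minimality
      forces \<open>\<bar>N\<bar> > 2 * r n\<close>, while off \<open>E2\<close> and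
      \<open>E3\<close> one has \<open>\<bar>N\<bar> < 2 * r n\<close>.\<close>
    define r where "r n = \<eta> * real n powr q / 16" for n
    define E1 where "E1 n = {\<omega> \<in> space M. (real n powr (- q / 2))\<^sup>2 * (\<Sum>k\<in>{1..<n}. (Z k \<omega>)\<^sup>2) \<le> 1}" for n
    define E2 where "E2 n = {\<omega> \<in> space M. r n \<le> \<bar>\<Sum>k=1..<n. y k \<omega> * Z k \<omega>\<bar>}" for n
    define E3 where "E3 n = {\<omega> \<in> space M. sqrt (r n) \<le> \<bar>y n \<omega>\<bar>}" for n
    have [measurable]: "E1 n \<in> sets M" "E2 n \<in> sets M" "E3 n \<in> sets M" for n
      by (simp_all add: E1_def E2_def E3_def)
    define b1 where "b1 n = 4 / 3 * ((1 + exp (- B * \<bar>real n powr (- q / 2)\<bar> powr \<alpha>)) / 2) ^ (n - 1)" for n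
    define b2 where "b2 n = real n * (Ky * Kz) / r n powr p" for n
    define b3 where "b3 n = Ky / sqrt (r n) powr p" for n
    have r: "0 < r n" if "1 \<le> n" for n using \<eta> that by (simp add: r_def)
    have p1: "prob (E1 n) \<le> b1 n" for n
    proof -
      \<comment> \<open>Coefficient \<open>u = 0\<close> removes the observation term, and
        \<open>a = 0\<close> admits every index set.\<close>
      have "expectation (\<lambda>\<omega>. cos (\<Sum>k\<in>G. v k * Z k \<omega>)) = (\<Prod>k\<in>G. exp (- B * \<bar>v k\<bar> powr \<alpha>))"
        if "finite G" "G \<subseteq> UNIV" for G v using ch[of G 0 0 v] that assms(2) by simp
      from prob_sum_power2_le[of Z UNIV "\<lambda>t. exp (- B * \<bar>t\<bar> powr \<alpha>)" "real n powr (- q / 2)" "{1..<n}", OF _ this]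
      show ?thesis by (simp add: E1_def b1_def)
    qed
    have p2: "prob (E2 n) \<le> b2 n" if "1 \<le> n" for n
      unfolding E2_def b2_def using K by (intro prob_powr_Markov pq r that mom_sum) auto
    have p3: "prob (E3 n) \<le> b3 n" if "1 \<le> n" for n
      unfolding E3_def b3_def using r[OF that] K by (intro prob_powr_Markov pq mom_y) auto
    have incl: "{\<omega> \<in> space M. \<bar>\<theta>\<^sub>h n \<omega> - \<theta>\<^sub>0\<bar> > \<epsilon>} \<subseteq> E1 n \<union> E2 n \<union> E3 n" if n: "1 \<le> n" for n
    proof (rule subsetI, rule ccontr)
      fix \<omega> assume w: "\<omega> \<in> {\<omega> \<in> space M. \<bar>\<theta>\<^sub>h n \<omega> - \<theta>\<^sub>0\<bar> > \<epsilon>}" "\<omega> \<notin> E1 n \<union> E2 n \<union> E3 n"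
      define S where "S = (\<Sum>k=1..n. (y k \<omega>)\<^sup>2)"
      define N where "N = (\<Sum>k=1..<n. y k \<omega> * Z k \<omega>) - c * (y n \<omega>)\<^sup>2"
      have "is_arg_min (whittle_fun \<alpha> \<Delta> (\<lambda>k. y k \<omega>) n) (\<lambda>\<theta>. \<theta> \<in> \<Theta>) (\<theta>\<^sub>h n \<omega>)"
        using assms(11) n w(1) by (simp add: whittle_estimator_def y_def)
      from whittle_arg_min_bound[OF n \<theta>\<^sub>0(1) this]
      have "S * \<bar>exp (\<theta>\<^sub>h n \<omega> * \<Delta>) - c\<bar> \<le> 2 * \<bar>N\<bar>"
        unfolding S_def N_def Z_def c_def[symmetric] lag_product_residual[OF n, of "\<lambda>k. y k \<omega>"] .
      moreover have "S * \<eta> \<le> S * \<bar>exp (\<theta>\<^sub>h n \<omega> * \<Delta>) - c\<bar>"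
        using w(1) by (intro mult_left_mono sep) (auto simp: S_def sum_nonneg)
      ultimately have SN: "S * \<eta> \<le> 2 * \<bar>N\<bar>" by linarith
      have eq: "(real n powr (- q / 2))\<^sup>2 = 1 / real n powr q"
        by (simp add: power2_eq_square powr_add[symmetric] powr_minus_divide)
      have "\<not> 1 / real n powr q * (\<Sum>k\<in>{1..<n}. (Z k \<omega>)\<^sup>2) \<le> 1"
        using w unfolding E1_def eq by blast
      then have "real n powr q < (\<Sum>k\<in>{1..<n}. (Z k \<omega>)\<^sup>2)"
        using n by (simp add: divide_le_eq)
      also have "\<dots> \<le> 4 * S"
        unfolding S_def Z_def using c by (intro sum_power2_residual_le) auto
      \<comment> \<open>The left side is \<open>16 * r n\<close>, and by \<open>SN\<close> the right
        side is at most \<open>8 * \<bar>N\<bar>\<close>.\<close>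
      finally have "real n powr q * \<eta> < 4 * S * \<eta>" using \<eta> by simp
      then have "8 * r n < 4 * \<bar>N\<bar>" using SN by (simp add: r_def mult_ac)
      moreover have "\<bar>N\<bar> < 2 * r n"
      proof -
        have "\<bar>y n \<omega>\<bar> < sqrt (r n)" using w by (auto simp: E3_def)
        then have "(y n \<omega>)\<^sup>2 < r n"
          using power_strict_mono[of "\<bar>y n \<omega>\<bar>" "sqrt (r n)" 2] r[OF n] by simp
        then have "c * (y n \<omega>)\<^sup>2 < r n"
          using c by (intro le_less_trans[OF mult_left_le_one_le]) auto
        moreover have "0 \<le> c * (y n \<omega>)\<^sup>2" using c by simp
        moreover have "\<bar>\<Sum>k=1..<n. y k \<omega> * Z k \<omega>\<bar> < r n" using w by (auto simp: E2_def)
        ultimately show ?thesis unfolding N_def by linarith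
      qed
      ultimately show False using r[OF n] by linarith
    qed
    have "b1 \<longlonglongrightarrow> 0"
      unfolding b1_def[abs_def] using AB pq assms(2) by (intro stable_sum_power2_rate)
    moreover have "b2 \<longlonglongrightarrow> 0"
    proof -
      \<comment> \<open>Linear growth of the moment of the sum meets the power
        \<open>q * p > 1\<close> of the threshold.\<close>
      have "(\<lambda>n. (Ky * Kz) / (\<eta> / 16) powr p * (real n * real n powr (- (q * p)))) \<longlonglongrightarrow> (Ky * Kz) / (\<eta> / 16) powr p * 0"
        using pq(5) by (intro tendsto_mult tendsto_const) real_asymp
      moreover have "b2 = (\<lambda>n. (Ky * Kz) / (\<eta> / 16) powr p * (real n * real n powr (- (q * p))))"
      proof
        fix n
        have "r n powr p = (\<eta> / 16) powr p * real n powr (q * p)"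
          using \<eta> powr_mult[of "\<eta> / 16" "real n powr q" p] by (simp add: r_def powr_powr)
        then show "b2 n = (Ky * Kz) / (\<eta> / 16) powr p * (real n * real n powr (- (q * p)))"
          by (simp add: b2_def powr_minus field_simps)
      qed
      ultimately show ?thesis by (simp only: mult_zero_right)
    qed
    moreover have "b3 \<longlonglongrightarrow> 0"
    proof -
      have "(\<lambda>n. Ky / sqrt (\<eta> / 16) powr p * (real n powr (- (q * p / 2)))) \<longlonglongrightarrow> Ky / sqrt (\<eta> / 16) powr p * 0"
      proof (intro tendsto_mult tendsto_const)
        have "0 < q * p / 2" using pq by simp
        then show "(\<lambda>n. real n powr (- (q * p / 2))) \<longlonglongrightarrow> 0" by real_asymp
      qed
      moreover have "b3 = (\<lambda>n. Ky / sqrt (\<eta> / 16) powr p * (real n powr (- (q * p / 2))))"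
      proof
        fix n
        have "sqrt (r n) = sqrt (\<eta> / 16) * real n powr (q / 2)"
          by (simp add: r_def real_sqrt_mult real_sqrt_divide powr_half_sqrt[symmetric] powr_powr)
        then have "sqrt (r n) powr p = sqrt (\<eta> / 16) powr p * real n powr (q * p / 2)"
          using \<eta> powr_mult[of "sqrt (\<eta> / 16)" "real n powr (q / 2)" p] by (simp add: powr_powr)
        then show "b3 n = Ky / sqrt (\<eta> / 16) powr p * (real n powr (- (q * p / 2)))"
          by (simp add: b3_def powr_minus field_simps)
      qed
      ultimately show ?thesis by (simp only: mult_zero_right)
    qed
    ultimately have "(\<lambda>n. b1 n + b2 n + b3 n) \<longlonglongrightarrow> 0 + 0 + 0" by (intro tendsto_add)
    then have lim: "(\<lambda>n. b1 n + b2 n + b3 n) \<longlonglongrightarrow> 0" by simp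
    show "(\<lambda>n. prob {\<omega> \<in> space M. \<bar>\<theta>\<^sub>h n \<omega> - \<theta>\<^sub>0\<bar> > \<epsilon>}) \<longlonglongrightarrow> 0"
    proof (rule tendsto_sandwich[OF _ _ tendsto_const lim])
      show "\<forall>\<^sub>F n in sequentially. prob {\<omega> \<in> space M. \<bar>\<theta>\<^sub>h n \<omega> - \<theta>\<^sub>0\<bar> > \<epsilon>} \<le> b1 n + b2 n + b3 n"
        using eventually_ge_at_top[of 1]
      proof eventually_elim
        case (elim n)
        have "prob {\<omega> \<in> space M. \<bar>\<theta>\<^sub>h n \<omega> - \<theta>\<^sub>0\<bar> > \<epsilon>} \<le> prob (E1 n \<union> E2 n \<union> E3 n)"
          by (intro finite_measure_mono incl elim) simp
        also have "\<dots> \<le> prob (E1 n \<union> E2 n) + prob (E3 n)" by (intro measure_Un_le) auto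
        also have "prob (E1 n \<union> E2 n) \<le> prob (E1 n) + prob (E2 n)" by (intro measure_Un_le) auto
        finally show ?case using p1[of n] p2[OF elim] p3[OF elim] by linarith
      qed
    qed auto
  qed
qed

end
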